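(* Assume that $F:C_\mu\to H$ is globally Lipschitz continuous; that $G$ maps $C_\mu$ into $L(U;D((-A)^\nu))$ for some $\nu\in(0,1)$ and is Lipschitz continuous, $\|G(x)-G(y)\|_{L(U;D((-A)^\nu))}\le L_{G,\nu}\|x-y\|_\mu$ for $x,y\in C_\mu$; and that there is a Lipschitz continuous map $K:C_\mu\to L(U;H)$ such that for every $T>0$ and every $u\in C([-\mu,T];H)$ the mapping $t\mapsto G(u_t)$ belongs to $C^1([0,T];L(U;H))$ with $\frac{d}{dt}G(u_t)=K(u_t)$. Then for every $\xi\in C_\mu$ and every $\omega\in\Omega$ there exists a unique global mild solution, i.e. a unique $u\in C([-\mu,\infty);H)$ with $u(t)=\xi(t)$ for $t\in[-\mu,0]$ and $$u(t)=S(t)\xi(0)+\int_0^t S(t-r)F(u_r)\,dr+\int_0^t A S(t-r)G(u_r)\omega(r)\,dr+G(u_t)\omega(t)-\int_0^t S(t-r)K(u_r)\omega(r)\,dr$$ for all $t\ge0$.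
   Context: $H$ and $U$ are separable Hilbert spaces with norms $|\cdot|$ and $|\cdot|_U$. Fix $\mu>0$; $C_\mu=C([-\mu,0];H)$ with sup norm $\|\cdot\|_\mu$. For a continuous $H$-valued function $u$ on $[-\mu,T]$ or $[-\mu,\infty)$ and $t\ge0$ in its domain, $u_t\in C_\mu$ is defined by $u_t(s)=u(t+s)$, $s\in[-\mu,0]$. $-A$ is a strictly positive symmetric (self-adjoint) operator on $H$ with compact inverse, and $A$ generates an analytic $C_0$-semigroup $S=(S(t))_{t\ge0}$ on $H$. $D((-A)^\gamma)$, $\gamma\ge0$, are the domains of the fractional powers with their usual norms. There is $\lambda>0$ such that for $t>0$ (constants normalized to $1$): $|S(t)|\le e^{-\lambda t}$; $|(-A)^\gamma S(t)|_{L(H)}\le t^{-\gamma}e^{-\lambda t}$ for $\gamma\in[0,1)$; $|S(t)-\mathrm{id}|_{L(D((-A)^\sigma),D((-A)^\theta))}\le t^{\sigma-\theta}$ for $\theta\ge0$, $\sigma\in[\theta,1+\theta]$. Fix $\beta\in(0,1/2)$. $\Omega$ is the set of continuous paths $\omega:\mathbb{R}\to U$ with $\omega(0)=0$ having finite $\beta$-Hölder seminorm on every interval $[-k,k]$, $k\in\mathbb{N}$. (It has full measure for the Wiener measure on $C_0(\mathbb{R};U)$ with a trace-class covariance operator $Q$.) The displayed equation is the pathwise meaning given to the mild form of the delay SPDE $du=(Au(t)+F(u_t))dt+G(u_t)dW(t)$, $u=\xi$ on $[-\mu,0]$: the stochastic integral $\int_0^tS(t-r)G(u_r)d\omega(r)$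 is interpreted as $G(u_t)\omega(t)+\int_0^tAS(t-r)G(u_r)\omega(r)dr-\int_0^tS(t-r)K(u_r)\omega(r)dr$. *)

theory Defs
  imports "HOL-Analysis.Analysis"
begin

section \<open>The unbounded operator and its semigroup\<close>

text \<open>An unbounded operator on H is a pair of a domain D and a total function A; the values of A
  outside D carry no meaning.\<close>

definition linear_operator :: "'h::real_vector set \<Rightarrow> ('h \<Rightarrow> 'h) \<Rightarrow> bool" where
  "linear_operator D A \<longleftrightarrow> subspace D \<and>
     (\<forall>x\<in>D. \<forall>y\<in>D. A (x + y) = A x + A y) \<and> (\<forall>c. \<forall>x\<in>D. A (c *\<^sub>R x) = c *\<^sub>R A x)"

text \<open>The last conjunct says that the graph of the adjoint (well defined by density of D)
  is the graph of A.\<close>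

definition self_adjoint :: "'h::real_inner set \<Rightarrow> ('h \<Rightarrow> 'h) \<Rightarrow> bool" where
  "self_adjoint D A \<longleftrightarrow> linear_operator D A \<and> closure D = UNIV \<and>
     (\<forall>y z. (\<forall>x\<in>D. inner (A x) y = inner x z) \<longleftrightarrow> (y \<in> D \<and> z = A y))"

definition strictly_positive :: "'h::real_inner set \<Rightarrow> ('h \<Rightarrow> 'h) \<Rightarrow> bool" where
  "strictly_positive D A \<longleftrightarrow> (\<forall>x\<in>D. x \<noteq> 0 \<longrightarrow> 0 < inner (A x) x)"

definition compact_inverse :: "'h::real_normed_vector set \<Rightarrow> ('h \<Rightarrow> 'h) \<Rightarrow> bool" where
  "compact_inverse D A \<longleftrightarrow> bij_betw A D UNIV \<and> compact (closure (inv_into D A ` cball 0 1))"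

definition C0_semigroup :: "(real \<Rightarrow> 'h::real_normed_vector \<Rightarrow>\<^sub>L 'h) \<Rightarrow> bool" where
  "C0_semigroup S \<longleftrightarrow> S 0 = id_blinfun \<and>
     (\<forall>s\<ge>0. \<forall>t\<ge>0. S (s + t) = S s o\<^sub>L S t) \<and>
     (\<forall>x. ((\<lambda>t. S t x) \<longlongrightarrow> x) (at_right 0))"

definition generates ::
    "'h::real_normed_vector set \<Rightarrow> ('h \<Rightarrow> 'h) \<Rightarrow> (real \<Rightarrow> 'h \<Rightarrow>\<^sub>L 'h) \<Rightarrow> bool" where
  "generates D A S \<longleftrightarrow>
     D = {x. \<exists>y. ((\<lambda>h. (S h x - x) /\<^sub>R h) \<longlongrightarrow> y) (at_right 0)} \<and>
     (\<forall>x\<in>D. ((\<lambda>h. (S h x - x) /\<^sub>R h) \<longlongrightarrow> A x) (at_right 0))"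

text \<open>H is a real Hilbert space, so analyticity is expressed on its complexification, realised as
  pairs (x, y) standing for x + i y.\<close>

definition times_i :: "'h::real_normed_vector \<times> 'h \<Rightarrow> 'h \<times> 'h" where
  "times_i w = (- snd w, fst w)"

definition sector :: "real \<Rightarrow> complex set" where
  "sector \<theta> = {z. z \<noteq> 0 \<and> \<bar>Arg z\<bar> < \<theta>}"

text \<open>The derivative clause is complex differentiability: the increment h acts on the derivative w'
  by complex multiplication.\<close>

definition sector_extension ::
    "(real \<Rightarrow> 'h::real_normed_vector \<Rightarrow>\<^sub>L 'h) \<Rightarrow> real \<Rightarrow> (complex \<Rightarrow> ('h \<times> 'h) \<Rightarrow>\<^sub>L ('h \<times> 'h)) \<Rightarrow> bool" where
  "sector_extension S \<theta> T \<longleftrightarrow>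
     (\<forall>t>0. \<forall>x y. T (complex_of_real t) (x, y) = (S t x, S t y)) \<and>
     (\<forall>z\<in>sector \<theta>. \<forall>w. T z (times_i w) = times_i (T z w)) \<and>
     (\<forall>z\<in>sector \<theta>. \<forall>z'\<in>sector \<theta>. T (z + z') = T z o\<^sub>L T z') \<and>
     (\<forall>z\<in>sector \<theta>. \<forall>w. \<exists>w'.
        ((\<lambda>\<zeta>. T \<zeta> w) has_derivative (\<lambda>h. Re h *\<^sub>R w' + Im h *\<^sub>R times_i w')) (at z)) \<and>
     (\<forall>w. ((\<lambda>z. T z w) \<longlongrightarrow> w) (at 0 within sector \<theta>))"

definition analytic_semigroup :: "(real \<Rightarrow> 'h::real_normed_vector \<Rightarrow>\<^sub>L 'h) \<Rightarrow> bool" where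
  "analytic_semigroup S \<longleftrightarrow>
     C0_semigroup S \<and> (\<exists>\<theta> T. 0 < \<theta> \<and> \<theta> \<le> pi / 2 \<and> sector_extension S \<theta> T)"

section \<open>Fractional powers\<close>

text \<open>For the generator A of an exponentially stable semigroup S, the negative powers of -A are
  given by the Gamma integral, and the positive powers are their inverses. The norm of
  the domain of a fractional power is the norm of the image under that power.\<close>

definition neg_frac_pow ::
    "(real \<Rightarrow> 'h::{real_inner, banach, second_countable_topology} \<Rightarrow>\<^sub>L 'h) \<Rightarrow> real \<Rightarrow> 'h \<Rightarrow> 'h" where
  "neg_frac_pow S \<gamma> x = (if \<gamma> = 0 then x
     else (1 / Gamma \<gamma>) *\<^sub>R (LINT s:{0<..}|lborel. (s powr (\<gamma> - 1)) *\<^sub>R S s x))"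

definition frac_dom ::
    "(real \<Rightarrow> 'h::{real_inner, banach, second_countable_topology} \<Rightarrow>\<^sub>L 'h) \<Rightarrow> real \<Rightarrow> 'h set" where
  "frac_dom S \<gamma> = range (neg_frac_pow S \<gamma>)"

definition frac_pow ::
    "(real \<Rightarrow> 'h::{real_inner, banach, second_countable_topology} \<Rightarrow>\<^sub>L 'h) \<Rightarrow> real \<Rightarrow> 'h \<Rightarrow> 'h" where
  "frac_pow S \<gamma> = inv (neg_frac_pow S \<gamma>)"

definition semigroup_estimates ::
    "(real \<Rightarrow> 'h::{real_inner, banach, second_countable_topology} \<Rightarrow>\<^sub>L 'h) \<Rightarrow> real \<Rightarrow> bool" where
  "semigroup_estimates S lam \<longleftrightarrow>
     (\<forall>t>0. norm (S t) \<le> exp (- lam * t)) \<and>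
     (\<forall>t>0. \<forall>\<gamma>\<in>{0..<1}. \<forall>x. S t x \<in> frac_dom S \<gamma> \<and>
        norm (frac_pow S \<gamma> (S t x)) \<le> t powr (- \<gamma>) * exp (- lam * t) * norm x) \<and>
     (\<forall>t>0. \<forall>\<theta>\<ge>0. \<forall>\<sigma>\<in>{\<theta>..1 + \<theta>}. \<forall>x\<in>frac_dom S \<sigma>. S t x - x \<in> frac_dom S \<theta> \<and>
        norm (frac_pow S \<theta> (S t x - x)) \<le> t powr (\<sigma> - \<theta>) * norm (frac_pow S \<sigma> x))"

text \<open>The Banach space of bounded linear maps from U into the domain of the fractional power,
  as a subset of the bounded linear maps from U into H.\<close>

definition L_frac ::
    "(real \<Rightarrow> 'h::{real_inner, banach, second_countable_topology} \<Rightarrow>\<^sub>L 'h) \<Rightarrow> real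
      \<Rightarrow> ('u::real_normed_vector \<Rightarrow>\<^sub>L 'h) set" where
  "L_frac S \<nu> = {g. range (blinfun_apply g) \<subseteq> frac_dom S \<nu> \<and> bounded_linear (\<lambda>v. frac_pow S \<nu> (g v))}"

definition norm_L_frac ::
    "(real \<Rightarrow> 'h::{real_inner, banach, second_countable_topology} \<Rightarrow>\<^sub>L 'h) \<Rightarrow> real
      \<Rightarrow> ('u::real_normed_vector \<Rightarrow>\<^sub>L 'h) \<Rightarrow> real" where
  "norm_L_frac S \<nu> g = onorm (\<lambda>v. frac_pow S \<nu> (g v))"

section \<open>Path segments and noise paths\<close>

text \<open>Functions on an interval are extensional, so that equality of functions is equality on the
  interval.\<close>

definition C_seg :: "real \<Rightarrow> (real \<Rightarrow> 'h::topological_space) set" where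
  "C_seg \<mu> = {x \<in> extensional {-\<mu>..0}. continuous_on {-\<mu>..0} x}"

definition norm_seg :: "real \<Rightarrow> (real \<Rightarrow> 'h::real_normed_vector) \<Rightarrow> real" where
  "norm_seg \<mu> x = (SUP s\<in>{-\<mu>..0}. norm (x s))"

definition seg :: "real \<Rightarrow> (real \<Rightarrow> 'h) \<Rightarrow> real \<Rightarrow> (real \<Rightarrow> 'h)" where
  "seg \<mu> u t = restrict (\<lambda>s. u (t + s)) {-\<mu>..0}"

definition lipschitz_seg ::
    "real \<Rightarrow> ((real \<Rightarrow> 'h::real_normed_vector) \<Rightarrow> 'b::real_normed_vector) \<Rightarrow> bool" where
  "lipschitz_seg \<mu> F \<longleftrightarrow>
     (\<exists>L. \<forall>x\<in>C_seg \<mu>. \<forall>y\<in>C_seg \<mu>. norm (F x - F y) \<le> L * norm_seg \<mu> (\<lambda>s. x s - y s))"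

definition noise_paths :: "real \<Rightarrow> (real \<Rightarrow> 'u::real_normed_vector) set" where
  "noise_paths \<beta> = {\<omega>. continuous_on UNIV \<omega> \<and> \<omega> 0 = 0 \<and>
     (\<forall>k::nat. \<exists>C. \<forall>s\<in>{- real k..real k}. \<forall>t\<in>{- real k..real k}.
        norm (\<omega> t - \<omega> s) \<le> C * \<bar>t - s\<bar> powr \<beta>)}"

section \<open>Mild solutions\<close>

text \<open>Integrability is demanded explicitly, because non-convergent Bochner integrals are 0 by
  convention. In the integral with A, the argument of A may lie outside its domain at the single
  point r = t, which is a null set.\<close>

definition global_mild_solution ::
    "real \<Rightarrow> ('h \<Rightarrow> 'h) \<Rightarrow> (real \<Rightarrow> 'h::{real_inner, banach, second_countable_topology} \<Rightarrow>\<^sub>L 'h)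
      \<Rightarrow> ((real \<Rightarrow> 'h) \<Rightarrow> 'h) \<Rightarrow> ((real \<Rightarrow> 'h) \<Rightarrow> ('u::real_normed_vector \<Rightarrow>\<^sub>L 'h))
      \<Rightarrow> ((real \<Rightarrow> 'h) \<Rightarrow> ('u \<Rightarrow>\<^sub>L 'h)) \<Rightarrow> (real \<Rightarrow> 'h) \<Rightarrow> (real \<Rightarrow> 'u) \<Rightarrow> (real \<Rightarrow> 'h) \<Rightarrow> bool" where
  "global_mild_solution \<mu> A S F G K \<xi> \<omega> u \<longleftrightarrow>
     u \<in> extensional {-\<mu>..} \<and> continuous_on {-\<mu>..} u \<and>
     (\<forall>t\<in>{-\<mu>..0}. u t = \<xi> t) \<and>
     (\<forall>t\<ge>0.
        set_integrable lborel {0..t} (\<lambda>r. S (t - r) (F (seg \<mu> u r))) \<and>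
        set_integrable lborel {0..t} (\<lambda>r. A (S (t - r) (G (seg \<mu> u r) (\<omega> r)))) \<and>
        set_integrable lborel {0..t} (\<lambda>r. S (t - r) (K (seg \<mu> u r) (\<omega> r))) \<and>
        u t = S t (\<xi> 0)
          + (LINT r:{0..t}|lborel. S (t - r) (F (seg \<mu> u r)))
          + (LINT r:{0..t}|lborel. A (S (t - r) (G (seg \<mu> u r) (\<omega> r))))
          + G (seg \<mu> u t) (\<omega> t)
          - (LINT r:{0..t}|lborel. S (t - r) (K (seg \<mu> u r) (\<omega> r))))"

end

theory Submission
  imports Defs
begin

text \<open>
  The mild equation is a fixed point equation \<open>u = \<Phi> u\<close> in the space of continuous functions on
  \<open>[-\<mu>, \<infinity>)\<close> that extend \<open>\<xi>\<close>. Each term that involves \<open>u\<close> depends on it in the manner of a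
  Volterra integral with a kernel \<open>(t - r) powr (a - 1)\<close>, \<open>a > 0\<close>. In the norm \<open>sup {exp (- \<rho> * t) * norm (u t) | t. 0 \<le> t \<le> T}\<close>
  such an operator has a Lipschitz constant of order
  \<open>\<integral>\<^sub>0\<^sup>T s powr (a - 1) * exp (- \<rho> * s) ds\<close>, which tends to \<open>0\<close> as \<open>\<rho> \<rightarrow> \<infinity>\<close>. So \<open>\<Phi>\<close> is a contraction
  on every interval \<open>[0, T]\<close> for a weight that depends on \<open>T\<close>, and the Picard iterates started on the
  whole half-line converge locally uniformly to the one and only fixed point
  (\<open>Bielecki_contraction_unique_fixed_point\<close>).

  For the two integrals with bounded integrands (\<open>F\<close> and \<open>K\<close>) this holds with \<open>a = 1\<close>. Two terms
  need an idea.

  The term \<open>G (u\<^sub>t) (\<omega> t)\<close> contains no integral, and the Lipschitz constant of \<open>G\<close> times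
  \<open>norm (\<omega> t)\<close> need not be small. But \<open>t \<mapsto> G (u\<^sub>t)\<close> has derivative \<open>K (u\<^sub>t)\<close> along every continuous
  path, and two admissible paths start from the same segment \<open>\<xi>\<close>. Hence
  \<open>G (u\<^sub>t) - G (v\<^sub>t) = \<integral>\<^sub>0\<^sup>t (K (u\<^sub>r) - K (v\<^sub>r)) dr\<close>, again a Volterra integral
  (\<open>norm_G_seg_diff_le\<close>).

  The term with \<open>A S (t - r)\<close> is singular. For \<open>x\<close> in the domain of \<open>(-A)\<close> to the power \<open>\<nu>\<close>
  the norm of \<open>A (S s x)\<close> is at most a constant times \<open>s powr (\<nu> - 1)\<close> times the norm of \<open>x\<close> there
  (\<open>norm_AS_frac_le\<close>), so \<open>a = \<nu>\<close>. To apply this to differences of values of \<open>G\<close>, the fractional power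
  must be linear; this rests on the injectivity of the negative fractional powers, which
  follows from the symmetry of the semigroup (\<open>neg_frac_pow_inj\<close>).
\<close>

section \<open>Weakly singular integrals\<close>

text \<open>A rescaled Gamma integral, brought from complex Henstock-Kurzweil form to the real Lebesgue measure.\<close>

lemma integrable_powr_exp:
  fixes a c :: real
  assumes "0 < a" "0 < c"
  shows "set_integrable lborel {0<..} (\<lambda>s. s powr (a - 1) * exp (- c * s))"
proof -
  have "(\<lambda>t. complex_of_real t powr (complex_of_real a - 1) / of_real (exp (c * t)))
      absolutely_integrable_on {0<..}"
    using absolutely_integrable_Gamma_integral[of "complex_of_real a" c] assms by simp
  then have "set_integrable lebesgue {0<..}
      (\<lambda>t. norm (complex_of_real t powr (complex_of_real a - 1) / of_real (exp (c * t))))"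
    by (rule set_integrable_norm)
  also have "?this \<longleftrightarrow> set_integrable lebesgue {0<..} (\<lambda>s. s powr (a - 1) * exp (- c * s))"
    by (intro set_integrable_cong)
       (auto simp: norm_divide norm_powr_real_powr exp_minus field_simps)
  finally have "integrable lebesgue (\<lambda>s. indicator {0<..} s *\<^sub>R (s powr (a - 1) * exp (- c * s)))"
    by (simp add: set_integrable_def)
  then show ?thesis
    unfolding set_integrable_def by (subst (asm) integrable_completion) measurable
qed

lemma integrable_powr_indicator:
  fixes a T :: real
  assumes "0 < a"
  shows "integrable lborel (\<lambda>s. indicator {0..T} s * s powr (a - 1))"
proof (rule Bochner_Integration.integrable_bound)
  show "integrable lborel (\<lambda>s. exp T * (indicator {0<..} s *\<^sub>R (s powr (a - 1) * exp (- 1 * s))))"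
    using integrable_powr_exp[OF assms, of 1] by (simp add: set_integrable_def)
  have "indicator {0..T} s * s powr (a - 1)
       \<le> exp T * (indicator {0<..} s *\<^sub>R (s powr (a - 1) * exp (- 1 * s)))" for s
    using mult_left_mono[of 1 "exp (T - s)" "s powr (a - 1)"]
    by (cases "0 < s"; cases "s \<le> T") (auto simp: exp_diff exp_minus field_simps indicator_def)
  then show "AE s in lborel. norm (indicator {0..T} s * s powr (a - 1))
       \<le> norm (exp T * (indicator {0<..} s *\<^sub>R (s powr (a - 1) * exp (- 1 * s))))"
    by (auto intro!: AE_I2)
qed measurable

text \<open>Up to the Lipschitz constants, this is the norm of a Volterra operator with kernel
  \<open>(t - r) powr (a - 1)\<close> on \<open>[0, T]\<close> with respect to the weight \<open>exp (\<rho> * t)\<close>.\<close>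

definition damped_mass :: "real \<Rightarrow> real \<Rightarrow> real \<Rightarrow> real" where
  "damped_mass a \<rho> T = (\<integral>s. indicator {0..T} s * s powr (a - 1) * exp (- \<rho> * s) \<partial>lborel)"

lemma damped_integrable:
  fixes a \<rho> T :: real
  assumes "0 < a" "0 \<le> \<rho>"
  shows "integrable lborel (\<lambda>s. indicator {0..T} s * s powr (a - 1) * exp (- \<rho> * s))"
proof (rule Bochner_Integration.integrable_bound[OF integrable_powr_indicator[OF assms(1)]])
  show "AE s in lborel. norm (indicator {0..T} s * s powr (a - 1) * exp (- \<rho> * s))
       \<le> norm (indicator {0..T} s * s powr (a - 1))"
    using assms by (auto intro!: AE_I2 mult_left_le simp: indicator_def)
qed measurable

lemma damped_mass_tendsto_0:
  assumes "0 < a"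
  shows "((\<lambda>\<rho>. damped_mass a \<rho> T) \<longlongrightarrow> 0) at_top"
proof -
  have "((\<lambda>\<rho>. damped_mass a \<rho> T) \<longlongrightarrow> (\<integral>s. 0 \<partial>(lborel :: real measure))) at_top"
    unfolding damped_mass_def
  proof (rule integral_dominated_convergence_at_top[OF _ _ integrable_powr_indicator[OF assms, of T]])
    show "\<forall>\<^sub>F \<rho> in at_top. AE s in lborel. norm (indicator {0..T} s * s powr (a - 1) * exp (- \<rho> * s))
         \<le> indicator {0..T} s * s powr (a - 1)"
      using eventually_ge_at_top[of 0]
      by eventually_elim (auto intro!: AE_I2 mult_left_le simp: indicator_def)
    have "((\<lambda>\<rho>. indicator {0..T} s * s powr (a - 1) * exp (- \<rho> * s)) \<longlongrightarrow> 0) at_top" for s :: real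
    proof (cases "0 < s")
      case True
      have "filterlim (\<lambda>\<rho>. - \<rho> * s) at_bot at_top"
        using True by real_asymp
      then have "((\<lambda>\<rho>. exp (- \<rho> * s)) \<longlongrightarrow> 0) at_top"
        by (rule filterlim_compose[OF exp_at_bot])
      then show ?thesis by (rule tendsto_mult_right_zero)
    qed (auto simp: indicator_def)
    then show "AE s in lborel. ((\<lambda>\<rho>. indicator {0..T} s * s powr (a - 1) * exp (- \<rho> * s)) \<longlongrightarrow> 0) at_top"
      by simp
  qed measurable
  then show ?thesis by simp
qed

text \<open>The substitution \<open>s = t - r\<close> moves the singularity of a convolution kernel from the moving point
  \<open>r = t\<close> to the fixed point \<open>s = 0\<close>.\<close>

lemma reflected_set_integral:
  fixes h :: "real \<Rightarrow> 'h::{banach, second_countable_topology}"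
  shows "(LINT r:{0..t}|lborel. h (t - r)) = (LINT s:{0..t}|lborel. h s)"
    and "set_integrable lborel {0..t} (\<lambda>r. h (t - r)) \<longleftrightarrow> set_integrable lborel {0..t} h"
proof -
  have ind: "indicator {0..t} (t - r) = (indicator {0..t} r :: real)" for r
    by (auto simp: indicator_def)
  show "(LINT r:{0..t}|lborel. h (t - r)) = (LINT s:{0..t}|lborel. h s)"
    unfolding set_lebesgue_integral_def
    by (subst (2) lborel_integral_real_affine[of "-1" _ t]) (simp_all add: ind)
  show "set_integrable lborel {0..t} (\<lambda>r. h (t - r)) \<longleftrightarrow> set_integrable lborel {0..t} h"
    unfolding set_integrable_def
    by (subst (2) lborel_integrable_real_affine_iff[of "-1" _ t, symmetric]) (simp_all add: ind)
qed

text \<open>The value \<open>h 0\<close> at the singularity is arbitrary; it enters the dominating function through a null set.\<close>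

lemma integrable_weakly_singular:
  fixes h :: "real \<Rightarrow> 'h::{banach, second_countable_topology}"
  assumes a: "0 < a" and cont: "continuous_on {0<..t} h"
    and bound: "\<And>s. s \<in> {0<..t} \<Longrightarrow> norm (h s) \<le> M * s powr (a - 1)"
  shows "set_integrable lborel {0..t} h"
  unfolding set_integrable_def
proof (rule Bochner_Integration.integrable_bound)
  show "integrable lborel (\<lambda>s. M * (indicator {0..t} s * s powr (a - 1)) + indicator {0} s *\<^sub>R norm (h 0))"
    using integrable_powr_indicator[OF a, of t] by simp
  have "(\<lambda>s. indicator {0<..t} s *\<^sub>R h s) \<in> borel_measurable borel"
    by (rule borel_measurable_continuous_on_indicator[OF _ cont]) simp
  moreover have "(\<lambda>s. indicator {0..t} s *\<^sub>R h s)
     = (\<lambda>s. indicator {0<..t} s *\<^sub>R h s + indicator {0} s *\<^sub>R (indicator {0..t} s *\<^sub>R h 0))"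
    by (auto simp: indicator_def fun_eq_iff)
  ultimately show "(\<lambda>s. indicator {0..t} s *\<^sub>R h s) \<in> borel_measurable lborel" by simp
  show "AE s in lborel. norm (indicator {0..t} s *\<^sub>R h s)
      \<le> norm (M * (indicator {0..t} s * s powr (a - 1)) + indicator {0} s *\<^sub>R norm (h 0))"
  proof (rule AE_I2)
    fix s
    consider "s = 0" | "s \<in> {0<..t}" | "s \<noteq> 0" "s \<notin> {0..t}" by fastforce
    then show "norm (indicator {0..t} s *\<^sub>R h s)
      \<le> norm (M * (indicator {0..t} s * s powr (a - 1)) + indicator {0} s *\<^sub>R norm (h 0))"
      by cases (use bound[of s] in \<open>auto simp: indicator_def\<close>)
  qed
qed

text \<open>After the substitution \<open>s = t - r\<close> the upper limit \<open>t\<close> occurs only in the indicator function and in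
  the continuous function \<open>g\<close>, and all integrands are dominated by \<open>M * s powr (a - 1)\<close>. So dominated
  convergence gives continuity in \<open>t\<close>, although the kernel may be unbounded near \<open>s = 0\<close>.\<close>

lemma continuous_on_weakly_singular_convolution:
  fixes P :: "real \<Rightarrow> 'a::topological_space \<Rightarrow> 'h::{banach, second_countable_topology}"
  assumes a: "0 < a"
    and P: "continuous_on ({0<..} \<times> UNIV) (\<lambda>(s, x). P s x)"
    and g: "continuous_on {0..T} g"
    and bound: "\<And>s r. s \<in> {0<..T} \<Longrightarrow> r \<in> {0..T} \<Longrightarrow> norm (P s (g r)) \<le> M * s powr (a - 1)"
  shows "t \<in> {0..T} \<Longrightarrow> set_integrable lborel {0..t} (\<lambda>r. P (t - r) (g r))"
    and "continuous_on {0..T} (\<lambda>t. LINT r:{0..t}|lborel. P (t - r) (g r))"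
proof -
  have Pg: "continuous_on J (\<lambda>s. P (f s) (g (k s)))"
    if "continuous_on J f" "continuous_on J k" "f ` J \<subseteq> {0<..}" "k ` J \<subseteq> {0..T}" for f k and J :: "real set"
    using continuous_on_compose2[OF P continuous_on_Pair[OF that(1) continuous_on_compose2[OF g that(2,4)]]]
      that(3) by auto
  have int: "set_integrable lborel {0..t} (\<lambda>s. P s (g (t - s)))" if t: "t \<in> {0..T}" for t
    using t by (intro integrable_weakly_singular[OF a Pg bound]) (auto intro!: continuous_intros)
  then show "set_integrable lborel {0..t} (\<lambda>r. P (t - r) (g r))" if "t \<in> {0..T}"
    using reflected_set_integral(2)[of t "\<lambda>s. P s (g (t - s))"] that by simp
  have M: "0 \<le> M" if "s \<in> {0<..T}" for s
    using norm_ge_zero[of "P s (g s)"] bound[of s s] that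
    by (smt (verit) atLeastAtMost_iff greaterThanAtMost_iff mult_neg_pos powr_gt_zero)
  have "continuous_on {0..T} (\<lambda>t. LINT s:{0..t}|lborel. P s (g (t - s)))"
    unfolding set_lebesgue_integral_def
  proof (rule continuous_on_sequentiallyI)
    fix \<tau> :: "nat \<Rightarrow> real" and t
    assume \<tau>: "\<forall>n. \<tau> n \<in> {0..T}" and t: "t \<in> {0..T}" and lim: "\<tau> \<longlonglongrightarrow> t"
    show "(\<lambda>n. \<integral>s. indicator {0..\<tau> n} s *\<^sub>R P s (g (\<tau> n - s)) \<partial>lborel)
       \<longlonglongrightarrow> (\<integral>s. indicator {0..t} s *\<^sub>R P s (g (t - s)) \<partial>lborel)"
    proof (rule integral_dominated_convergence)
      show "integrable lborel (\<lambda>s. M * (indicator {0..T} s * s powr (a - 1)))"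
        using integrable_powr_indicator[OF a, of T] by simp
      show "(\<lambda>s. indicator {0..t} s *\<^sub>R P s (g (t - s))) \<in> borel_measurable lborel"
        "\<And>n. (\<lambda>s. indicator {0..\<tau> n} s *\<^sub>R P s (g (\<tau> n - s))) \<in> borel_measurable lborel"
        using int t \<tau> unfolding set_integrable_def by (blast intro: borel_measurable_integrable)+
      \<comment> \<open>The kernel is uncontrolled at 0, and the indicator functions need not converge at t.\<close>
      have exc: "AE s in lborel. s \<noteq> 0 \<and> s \<noteq> t"
        using AE_lborel_singleton[of 0] AE_lborel_singleton[of t] by eventually_elim auto
      show "AE s in lborel. norm (indicator {0..\<tau> n} s *\<^sub>R P s (g (\<tau> n - s)))
          \<le> M * (indicator {0..T} s * s powr (a - 1))" for n
        using exc
      proof eventually_elim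
        case (elim s)
        then show ?case
          using bound[of s "\<tau> n - s"] \<tau>[rule_format, of n] M[of s]
          by (auto simp: indicator_def)
      qed
      show "AE s in lborel. (\<lambda>n. indicator {0..\<tau> n} s *\<^sub>R P s (g (\<tau> n - s)))
          \<longlonglongrightarrow> indicator {0..t} s *\<^sub>R P s (g (t - s))"
        using exc
      proof eventually_elim
        case (elim s)
        consider "s < 0" | "0 < s" "s < t" | "t < s" using elim by linarith
        then show ?case
        proof cases
          case 2
          have "\<forall>\<^sub>F n in sequentially. s < \<tau> n" by (rule order_tendstoD(1)[OF lim 2(2)])
          then have ev: "\<forall>\<^sub>F n in sequentially. P s (g (\<tau> n - s)) = indicator {0..\<tau> n} s *\<^sub>R P s (g (\<tau> n - s))"
            by eventually_elim (use 2 in auto)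
          have "continuous_on {s..T} (\<lambda>t. P s (g (t - s)))"
            using 2 by (intro Pg) (auto intro!: continuous_intros)
          then have "(\<lambda>n. P s (g (\<tau> n - s))) \<longlonglongrightarrow> P s (g (t - s))"
            using 2 t \<open>\<forall>\<^sub>F n in sequentially. s < \<tau> n\<close> \<tau>
            by (intro continuous_on_tendsto_compose[where g=\<tau>, OF _ lim]) (auto elim!: eventually_mono)
          then show ?thesis using Lim_transform_eventually[OF _ ev] 2 by simp
        next
          case 3
          have "\<forall>\<^sub>F n in sequentially. \<tau> n < s" by (rule order_tendstoD(2)[OF lim 3])
          then have "\<forall>\<^sub>F n in sequentially. 0 = indicator {0..\<tau> n} s *\<^sub>R P s (g (\<tau> n - s))"
            by eventually_elim auto
          then show ?thesis using 3 by (auto intro: Lim_transform_eventually[OF tendsto_const])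
        qed auto
      qed
    qed
  qed
  moreover have "(LINT r:{0..t}|lborel. P (t - r) (g r)) = (LINT s:{0..t}|lborel. P s (g (t - s)))" for t
    using reflected_set_integral(1)[of t "\<lambda>s. P s (g (t - s))"] by simp
  ultimately show "continuous_on {0..T} (\<lambda>t. LINT r:{0..t}|lborel. P (t - r) (g r))" by simp
qed

text \<open>The basic Volterra estimate: writing \<open>exp (\<rho> * r) = exp (\<rho> * t) * exp (- \<rho> * (t - r))\<close> pulls the
  weight out of the integral and leaves the damped kernel. The two integrands are compared as a pair,
  not through their difference inside one convolution, because the kernel of the application,
  \<open>A \<circ> S s\<close>, is linear only for \<open>s > 0\<close>.\<close>

lemma weakly_singular_integral_diff_le:
  fixes h k :: "real \<Rightarrow> 'h::{banach, second_countable_topology}"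
  assumes a: "0 < a" and \<rho>: "0 \<le> \<rho>" and t: "t \<in> {0..T}" and M: "0 \<le> M"
    and int: "set_integrable lborel {0..t} h" "set_integrable lborel {0..t} k"
    and bound: "\<And>r. 0 \<le> r \<Longrightarrow> r < t \<Longrightarrow>
       norm (h r - k r) \<le> M * (t - r) powr (a - 1) * exp (\<rho> * r)"
  shows "norm ((LINT r:{0..t}|lborel. h r) - (LINT r:{0..t}|lborel. k r))
       \<le> M * damped_mass a \<rho> T * exp (\<rho> * t)"
proof -
  let ?w = "\<lambda>s. indicator {0..T} s * s powr (a - 1) * exp (- \<rho> * s)"
  have w: "integrable lborel ?w" by (rule damped_integrable[OF a \<rho>])
  have "norm ((LINT r:{0..t}|lborel. h r) - (LINT r:{0..t}|lborel. k r))
      = norm (LINT r:{0..t}|lborel. h r - k r)"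
    by (simp add: set_integral_diff int)
  also have "\<dots> \<le> (\<integral>r. M * exp (\<rho> * t) * ?w (t - r) \<partial>lborel)"
    unfolding set_lebesgue_integral_def
  proof (rule order_trans[OF integral_norm_bound integral_mono_AE])
    show "integrable lborel (\<lambda>r. norm (indicator {0..t} r *\<^sub>R (h r - k r)))"
      using integrable_norm[OF set_integral_diff(1)[OF int, unfolded set_integrable_def]] .
    show "integrable lborel (\<lambda>r. M * exp (\<rho> * t) * ?w (t - r))"
      using lborel_integrable_real_affine[OF w, of "-1" t] by simp
    have "AE r in lborel. r \<noteq> t" by (rule AE_lborel_singleton)
    then show "AE r in lborel. norm (indicator {0..t} r *\<^sub>R (h r - k r)) \<le> M * exp (\<rho> * t) * ?w (t - r)"
    proof eventually_elim
      case (elim r)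
      show ?case
      proof (cases "r \<in> {0..<t}")
        case True
        have *: "exp (\<rho> * r) = exp (\<rho> * t) * exp (- \<rho> * (t - r))"
          by (simp flip: exp_add add: algebra_simps)
        show ?thesis using bound[of r] True t unfolding *
          by (simp add: indicator_def mult_ac)
      next
        case False
        then show ?thesis using elim M by (auto simp: indicator_def)
      qed
    qed
  qed
  also have "\<dots> = M * exp (\<rho> * t) * damped_mass a \<rho> T"
    unfolding damped_mass_def
    by (subst lborel_integral_real_affine[of "-1" ?w t]) simp_all
  finally show ?thesis by (simp add: mult_ac)
qed

section \<open>Contractions in exponentially weighted norms\<close>

lemma continuous_on_atLeastI:
  fixes f :: "real \<Rightarrow> 'b::topological_space"
  assumes "\<And>T. b < T \<Longrightarrow> continuous_on {a..T} f"
  shows "continuous_on {a..} f"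
  unfolding continuous_on_eq_continuous_within
proof
  fix t assume t: "t \<in> {a..}"
  define T where "T = max b t + 1"
  have "continuous (at t within {a..T}) f"
    using assms[of T] t by (auto simp: continuous_on_eq_continuous_within T_def)
  moreover have "at t within {a..T} = at t within {a..}"
    by (rule at_within_nhd[of _ "{..<T}"]) (auto simp: T_def)
  ultimately show "continuous (at t within {a..}) f" by simp
qed

text \<open>The weight and the contraction factor may depend on the interval \<open>[0, T]\<close>, so there is no single
  complete metric in which \<open>\<Phi>\<close> is a contraction. The iterates of \<open>\<Phi>\<close> do not depend on \<open>T\<close>, however: on each
  interval their differences are dominated by a geometric series, and the locally uniform limit
  is a fixed point on the whole half-line. No solutions on bounded intervals have to be glued together.\<close>

lemma Bielecki_contraction_unique_fixed_point:
  fixes \<Phi> :: "(real \<Rightarrow> 'h::banach) \<Rightarrow> real \<Rightarrow> 'h"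
  assumes X_def: "X = {u \<in> extensional {-\<mu>..}. continuous_on {-\<mu>..} u \<and> (\<forall>t\<in>{-\<mu>..0}. u t = \<xi> t)}"
    and \<mu>: "0 \<le> \<mu>"
    and maps: "\<And>u. u \<in> X \<Longrightarrow> \<Phi> u \<in> X" and ne: "u0 \<in> X"
    and contr: "\<And>T. 0 < T \<Longrightarrow> \<exists>\<rho>\<ge>0. \<exists>q\<in>{0..<1}. \<forall>u\<in>X. \<forall>v\<in>X. \<forall>m\<ge>0.
       (\<forall>t\<in>{0..T}. norm (u t - v t) \<le> m * exp (\<rho> * t)) \<longrightarrow>
       (\<forall>t\<in>{0..T}. norm (\<Phi> u t - \<Phi> v t) \<le> q * m * exp (\<rho> * t))"
  shows "\<exists>!u. u \<in> X \<and> \<Phi> u = u"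
proof -
  have power_X: "(\<Phi> ^^ n) u \<in> X" if "u \<in> X" for n u
    using that maps by (induction n) auto
  have decay: "\<exists>q M. 0 \<le> q \<and> q < 1 \<and>
      (\<forall>n. \<forall>t\<in>{-\<mu>..T}. norm ((\<Phi> ^^ n) u t - (\<Phi> ^^ n) v t) \<le> q ^ n * M)"
    if u: "u \<in> X" and v: "v \<in> X" and T: "0 < T" for u v T
  proof -
    obtain \<rho> q where \<rho>: "0 \<le> \<rho>" and q: "0 \<le> q" "q < 1" and
      c: "\<And>u v m. u \<in> X \<Longrightarrow> v \<in> X \<Longrightarrow> 0 \<le> m \<Longrightarrow> \<forall>t\<in>{0..T}. norm (u t - v t) \<le> m * exp (\<rho> * t)
        \<Longrightarrow> \<forall>t\<in>{0..T}. norm (\<Phi> u t - \<Phi> v t) \<le> q * m * exp (\<rho> * t)"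
      using contr[OF T] by (auto simp: Bex_def)
    have "continuous_on {0..T} (\<lambda>t. norm (u t - v t))"
      using u v \<mu> by (intro continuous_intros) (auto simp: X_def elim: continuous_on_subset)
    then have "bounded ((\<lambda>t. norm (u t - v t)) ` {0..T})"
      by (intro compact_imp_bounded compact_continuous_image) auto
    then obtain m where m: "\<And>t. t \<in> {0..T} \<Longrightarrow> norm (u t - v t) \<le> m"
      unfolding bounded_iff by force
    have m0: "0 \<le> m" using order_trans[OF norm_ge_zero m[of 0]] T by simp
    have iter: "\<forall>t\<in>{0..T}. norm ((\<Phi> ^^ n) u t - (\<Phi> ^^ n) v t) \<le> q ^ n * m * exp (\<rho> * t)" for n
    proof (induction n)
      case 0
      have "m \<le> m * exp (\<rho> * t)" if "t \<in> {0..T}" for t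
        using mult_left_mono[of 1 "exp (\<rho> * t)" m] m0 \<rho> that by auto
      then show ?case using m by force
    next
      case (Suc n)
      then show ?case
        using c[OF power_X[OF u] power_X[OF v], of "q ^ n * m" n n] q m0 by (simp add: mult_ac)
    qed
    have "norm ((\<Phi> ^^ n) u t - (\<Phi> ^^ n) v t) \<le> q ^ n * (m * exp (\<rho> * T))" if "t \<in> {-\<mu>..T}" for n t
    proof (cases "0 \<le> t")
      case True
      have "q ^ n * m * exp (\<rho> * t) \<le> q ^ n * m * exp (\<rho> * T)"
        using that True q m0 \<rho> by (intro mult_left_mono) (auto intro: mult_left_mono)
      moreover have "norm ((\<Phi> ^^ n) u t - (\<Phi> ^^ n) v t) \<le> q ^ n * m * exp (\<rho> * t)"
        using iter True that by simp
      ultimately show ?thesis by (simp add: mult.assoc)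
    next
      case False
      then show ?thesis
        using power_X[OF u, of n] power_X[OF v, of n] that q m0 by (simp add: X_def)
    qed
    then show ?thesis using q by blast
  qed
  \<comment> \<open>Existence: the Picard iterates converge by the Weierstrass test for their telescoping series.\<close>
  define U where "U n = (\<Phi> ^^ n) u0" for n
  define u where "u t = (if -\<mu> \<le> t then lim (\<lambda>n. U n t) else undefined)" for t
  have U: "U n \<in> X" "U (Suc n) = \<Phi> (U n)" for n
    using power_X[OF ne] by (auto simp: U_def)
  have limit: "uniform_limit {-\<mu>..T} U u sequentially" if T: "0 < T" for T
  proof -
    obtain q M where q: "0 \<le> q" "q < 1"
      and b: "\<And>n t. t \<in> {-\<mu>..T} \<Longrightarrow> norm ((\<Phi> ^^ n) (\<Phi> u0) t - (\<Phi> ^^ n) u0 t) \<le> q ^ n * M"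
      using decay[OF maps[OF ne] ne T] by blast
    have "summable (\<lambda>n. q ^ n * M)"
      using q by (intro summable_mult2 summable_geometric) auto
    then have "uniform_limit {-\<mu>..T} (\<lambda>n t. \<Sum>k<n. U (Suc k) t - U k t)
        (\<lambda>t. \<Sum>k. U (Suc k) t - U k t) sequentially"
      using b by (intro Weierstrass_m_test) (auto simp: U_def funpow_swap1)
    then have "uniform_limit {-\<mu>..T} (\<lambda>n t. U n t - U 0 t) (\<lambda>t. \<Sum>k. U (Suc k) t - U k t) sequentially"
      by (simp add: sum_lessThan_telescope[of "\<lambda>k. U k _"])
    from uniform_limit_add[OF this uniform_limit_const, of "U 0"]
    have l: "uniform_limit {-\<mu>..T} U (\<lambda>t. (\<Sum>k. U (Suc k) t - U k t) + U 0 t) sequentially"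
      by simp
    have "u t = (\<Sum>k. U (Suc k) t - U k t) + U 0 t" if "t \<in> {-\<mu>..T}" for t
      using limI[OF tendsto_uniform_limitI[OF l that]] that by (simp add: u_def)
    then show ?thesis using l by (subst uniform_limit_cong') auto
  qed
  have pointwise: "(\<lambda>n. U n t) \<longlonglongrightarrow> u t" if "-\<mu> \<le> t" for t
    using tendsto_uniform_limitI[OF limit[of "max 1 t"], of t] that by auto
  have "continuous_on {-\<mu>..} u"
  proof (rule continuous_on_atLeastI[of 0])
    fix T :: real assume "0 < T"
    have "continuous_on {-\<mu>..T} (U n)" for n
      using U(1)[of n] by (auto simp: X_def elim: continuous_on_subset)
    then show "continuous_on {-\<mu>..T} u"
      by (intro uniform_limit_theorem[OF _ limit[OF \<open>0 < T\<close>]]) auto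
  qed
  moreover have "u t = \<xi> t" if "t \<in> {-\<mu>..0}" for t
    using pointwise[of t] U(1) that by (simp add: X_def LIMSEQ_const_iff)
  ultimately have u_X: "u \<in> X"
    by (auto simp: X_def u_def extensional_def)
  have "\<Phi> u t = u t" for t
  proof (cases "0 < t")
    case True
    obtain \<rho> q where \<rho>: "0 \<le> \<rho>" and q: "0 \<le> q" "q < 1" and
      c: "\<And>u v m. u \<in> X \<Longrightarrow> v \<in> X \<Longrightarrow> 0 \<le> m \<Longrightarrow> \<forall>s\<in>{0..t}. norm (u s - v s) \<le> m * exp (\<rho> * s)
        \<Longrightarrow> \<forall>s\<in>{0..t}. norm (\<Phi> u s - \<Phi> v s) \<le> q * m * exp (\<rho> * s)"
      using contr[OF True] by (auto simp: Bex_def)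
    have "(\<lambda>n. U (Suc n) t) \<longlonglongrightarrow> \<Phi> u t"
    proof (rule metric_LIMSEQ_I)
      fix e :: real assume e: "0 < e"
      define d where "d = e / exp (\<rho> * t)"
      have d: "0 < d" using e by (simp add: d_def)
      obtain N where N: "\<And>n s. N \<le> n \<Longrightarrow> s \<in> {-\<mu>..t} \<Longrightarrow> dist (U n s) (u s) < d"
        using uniform_limitD[OF limit[OF True] d] unfolding eventually_sequentially by blast
      have "dist (U (Suc n) t) (\<Phi> u t) < e" if "N \<le> n" for n
      proof -
        have "norm (U n s - u s) \<le> d * exp (\<rho> * s)" if s: "s \<in> {0..t}" for s
        proof -
          have "norm (U n s - u s) \<le> d * 1"
            using N[OF \<open>N \<le> n\<close>, of s] s \<mu> by (simp add: dist_norm)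
          also have "\<dots> \<le> d * exp (\<rho> * s)" using s \<rho> d by (intro mult_left_mono) auto
          finally show ?thesis .
        qed
        then have "norm (\<Phi> (U n) t - \<Phi> u t) \<le> q * d * exp (\<rho> * t)"
          using c[OF U(1) u_X, of d n] d True by auto
        also have "\<dots> < e" using q e by (simp add: d_def)
        finally show ?thesis by (simp add: U dist_norm)
      qed
      then show "\<exists>N. \<forall>n\<ge>N. dist (U (Suc n) t) (\<Phi> u t) < e" by blast
    qed
    moreover have "(\<lambda>n. U (Suc n) t) \<longlonglongrightarrow> u t"
      using pointwise[of t] True \<mu> by (intro LIMSEQ_Suc) auto
    ultimately show ?thesis by (rule LIMSEQ_unique)
  next
    case False
    then show ?thesis
      using u_X maps[OF u_X] by (cases "-\<mu> \<le> t") (auto simp: X_def extensional_def)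
  qed
  then have fix_u: "\<Phi> u = u" by blast
  \<comment> \<open>Uniqueness: two fixed points are their own iterates, so their distance decays geometrically.\<close>
  have "v = u" if v: "v \<in> X" "\<Phi> v = v" for v
  proof
    fix t
    have power: "(\<Phi> ^^ n) v = v" "(\<Phi> ^^ n) u = u" for n
      using v(2) fix_u by (induction n) auto
    show "v t = u t"
    proof (cases "-\<mu> \<le> t")
      case True
      obtain q M where q: "0 \<le> q" "q < 1" and b: "\<And>n. norm (v t - u t) \<le> q ^ n * M"
        using decay[OF v(1) u_X, of "max 1 t"] True unfolding power by fastforce
      have "(\<lambda>n. q ^ n * M) \<longlonglongrightarrow> 0"
        using q by (intro tendsto_mult_left_zero LIMSEQ_power_zero) auto
      then have "norm (v t - u t) \<le> 0"
        by (rule tendsto_lowerbound) (use b in auto)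
      then show ?thesis by simp
    qed (use v u_X in \<open>auto simp: X_def extensional_def\<close>)
  qed
  with u_X fix_u show ?thesis by blast
qed

section \<open>The semigroup and its fractional powers\<close>

lemma has_vector_derivative_right_quotient:
  assumes "(f has_vector_derivative f') (at t)"
  shows "((\<lambda>h. (f (t + h) - f t) /\<^sub>R h) \<longlongrightarrow> f') (at_right 0)"
proof -
  have "((\<lambda>h. norm (f (t + h) - f t - h *\<^sub>R f') / norm h) \<longlongrightarrow> 0) (at_right 0)"
    using assms unfolding has_vector_derivative_def has_derivative_at
    by (auto intro: filterlim_mono[OF _ order_refl at_le])
  then have "((\<lambda>h. norm ((f (t + h) - f t) /\<^sub>R h - f')) \<longlongrightarrow> 0) (at_right 0)"
  proof (rule Lim_transform_eventually, intro eventually_at_rightI[of 0 1])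
    fix h :: real assume "h \<in> {0<..<1}"
    then have "(f (t + h) - f t) /\<^sub>R h - f' = (f (t + h) - f t - h *\<^sub>R f') /\<^sub>R h"
      by (simp add: scaleR_diff_right)
    then show "norm (f (t + h) - f t - h *\<^sub>R f') / norm h = norm ((f (t + h) - f t) /\<^sub>R h - f')"
      by (simp only: norm_scaleR) (simp add: divide_inverse)
  qed simp
  then show ?thesis by (simp add: tendsto_norm_zero_iff LIM_zero_iff)
qed

locale parabolic_semigroup =
  fixes D :: "'h::{real_inner, banach, second_countable_topology} set"
    and A :: "'h \<Rightarrow> 'h"
    and S :: "real \<Rightarrow> 'h \<Rightarrow>\<^sub>L 'h"
    and lam :: real
  assumes selfadj: "self_adjoint D (\<lambda>x. - A x)"
    and analytic: "analytic_semigroup S"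
    and gen: "generates D A S"
    and lam_pos: "0 < lam"
    and est: "semigroup_estimates S lam"
begin

lemma S_zero: "S 0 x = x"
  and S_add: "0 \<le> s \<Longrightarrow> 0 \<le> t \<Longrightarrow> S (s + t) x = S s (S t x)"
  and S_tendsto: "((\<lambda>t. S t x) \<longlongrightarrow> x) (at_right 0)"
proof -
  have "C0_semigroup S" using analytic unfolding analytic_semigroup_def by (rule conjunct1)
  then have *: "S 0 = id_blinfun" "\<And>s t. 0 \<le> s \<Longrightarrow> 0 \<le> t \<Longrightarrow> S (s + t) = S s o\<^sub>L S t"
    "((\<lambda>t. S t x) \<longlongrightarrow> x) (at_right 0)"
    unfolding C0_semigroup_def by blast+
  show "S 0 x = x" by (simp add: *(1))
  show "S (s + t) x = S s (S t x)" if "0 \<le> s" "0 \<le> t" by (simp add: *(2) that)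
  show "((\<lambda>t. S t x) \<longlongrightarrow> x) (at_right 0)" by (rule *(3))
qed

lemma norm_S_exp:
  assumes "0 < t" shows "norm (S t x) \<le> exp (- lam * t) * norm x"
proof -
  have "norm (S t) \<le> exp (- lam * t)"
    using est assms unfolding semigroup_estimates_def by blast
  then show ?thesis
    by (intro order_trans[OF norm_blinfun] mult_right_mono norm_ge_zero)
qed

lemma norm_S_le:
  assumes "0 \<le> t" shows "norm (S t x) \<le> norm x"
proof (cases "t = 0")
  case False
  then have "norm (S t x) \<le> exp (- lam * t) * norm x" using assms norm_S_exp by simp
  also have "\<dots> \<le> 1 * norm x"
    using assms lam_pos by (intro mult_right_mono) auto
  finally show ?thesis by simp
qed (simp add: S_zero)

lemma S_diff_le:
  assumes "0 \<le> s" "0 \<le> t"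
  shows "norm (S t x - S s x) \<le> norm (S \<bar>t - s\<bar> x - x)"
proof -
  have *: "norm (S t x - S s x) \<le> norm (S (t - s) x - x)" if "0 \<le> s" "s \<le> t" for s t
  proof -
    have "S t x - S s x = S s (S (t - s) x - x)"
      using S_add[of s "t - s" x] that by (simp add: blinfun.diff_right)
    then show ?thesis using norm_S_le[of s] that by metis
  qed
  show ?thesis
  proof (cases "s \<le> t")
    case False
    then show ?thesis using *[of t s] assms by (simp add: norm_minus_commute)
  qed (use * assms in auto)
qed

text \<open>As \<open>S s\<close> is a contraction for every \<open>s\<close>, both variables can be compared separately with a fixed point.\<close>

lemma S_joint_continuous: "continuous_on ({0..} \<times> UNIV) (\<lambda>(s, x). S s x)"
proof (clarsimp simp: continuous_on_def split_beta)
  fix s0 :: real and x0 :: 'h assume s0: "0 \<le> s0"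
  let ?F = "at (s0, x0) within {0..} \<times> UNIV"
  have f: "(fst \<longlongrightarrow> s0) ?F" and g: "(snd \<longlongrightarrow> x0) ?F"
    using tendsto_fst[OF tendsto_ident_at, of "(s0,x0)"] tendsto_snd[OF tendsto_ident_at, of "(s0,x0)"]
    by auto
  have "((\<lambda>t. S t x0) \<longlongrightarrow> S 0 x0) (at 0 within {0..})"
    using S_tendsto[of x0] by (simp add: S_zero at_within_Ici_at_right)
  then have c: "continuous (at 0 within {0..}) (\<lambda>t. S t x0)"
    by (simp add: continuous_within)
  have l: "((\<lambda>p. \<bar>fst p - s0\<bar>) \<longlongrightarrow> 0) ?F"
    using tendsto_rabs[OF tendsto_diff[OF f tendsto_const[of s0]]] by simp
  have "((\<lambda>p. S \<bar>fst p - s0\<bar> x0) \<longlongrightarrow> S 0 x0) ?F"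
    using continuous_within_tendsto_compose'[OF c _ l] by simp
  from tendsto_add[OF tendsto_norm[OF tendsto_diff[OF this tendsto_const[of x0]]]
        tendsto_norm[OF tendsto_diff[OF g tendsto_const[of x0]]]]
  have "((\<lambda>p. norm (S \<bar>fst p - s0\<bar> x0 - x0) + norm (snd p - x0)) \<longlongrightarrow> 0) ?F"
    by (simp add: S_zero)
  moreover have "\<forall>\<^sub>F p in ?F. norm (S (fst p) (snd p) - S s0 x0)
       \<le> norm (S \<bar>fst p - s0\<bar> x0 - x0) + norm (snd p - x0)"
  proof (rule eventually_mono)
    show "\<forall>\<^sub>F p in ?F. p \<in> {0..} \<times> UNIV" by (auto simp: eventually_at_filter)
    fix p :: "real \<times> 'h" assume p: "p \<in> {0..} \<times> UNIV"
    have "S (fst p) (snd p) - S s0 x0 = (S (fst p) x0 - S s0 x0) + S (fst p) (snd p - x0)"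
      by (simp add: blinfun.diff_right)
    also have "norm \<dots> \<le> norm (S \<bar>fst p - s0\<bar> x0 - x0) + norm (snd p - x0)"
      using S_diff_le[of s0 "fst p" x0] norm_S_le[of "fst p" "snd p - x0"] p s0
      by (intro norm_triangle_mono) auto
    finally show "norm (S (fst p) (snd p) - S s0 x0)
       \<le> norm (S \<bar>fst p - s0\<bar> x0 - x0) + norm (snd p - x0)" .
  qed
  ultimately have "((\<lambda>p. S (fst p) (snd p) - S s0 x0) \<longlongrightarrow> 0) ?F"
    by (rule Lim_null_comparison[rotated])
  then show "((\<lambda>p. S (fst p) (snd p)) \<longlongrightarrow> S s0 x0) ?F"
    by (simp add: LIM_zero_iff)
qed

lemma S_continuous:
  assumes "continuous_on T f" "continuous_on T g" "\<And>t. t \<in> T \<Longrightarrow> 0 \<le> f t"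
  shows "continuous_on T (\<lambda>t. S (f t) (g t))"
  using continuous_on_compose2[OF S_joint_continuous continuous_on_Pair[OF assms(1,2)]] assms(3)
  by (auto simp: split_beta)

lemma generator_tendsto: "x \<in> D \<Longrightarrow> ((\<lambda>h. (S h x - x) /\<^sub>R h) \<longlongrightarrow> A x) (at_right 0)"
  and generator_domain: "((\<lambda>h. (S h x - x) /\<^sub>R h) \<longlongrightarrow> y) (at_right 0) \<Longrightarrow> x \<in> D"
  using gen unfolding generates_def by auto

lemma generator_eq: "((\<lambda>h. (S h x - x) /\<^sub>R h) \<longlongrightarrow> y) (at_right 0) \<Longrightarrow> A x = y"
  using generator_tendsto[OF generator_domain] tendsto_unique[OF trivial_limit_at_right_real] by blast

text \<open>On the positive half-axis the complex derivative restricts to a real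
  two-sided derivative of the orbit. Its right-hand part is the limit that defines the generator at \<open>S t x\<close>; this puts
  \<open>S t x\<close> into the domain and identifies the derivative.\<close>

lemma S_has_vector_derivative:
  assumes t: "0 < t"
  shows "S t x \<in> D" and "((\<lambda>t. S t x) has_vector_derivative A (S t x)) (at t)"
proof -
  obtain \<theta> T where \<theta>: "0 < \<theta>" and T: "sector_extension S \<theta> T"
    using analytic unfolding analytic_semigroup_def by blast
  have "complex_of_real t \<in> sector \<theta>" using t \<theta> by (simp add: sector_def)
  then obtain w' where w': "((\<lambda>\<zeta>. T \<zeta> (x, 0)) has_derivative (\<lambda>h. Re h *\<^sub>R w' + Im h *\<^sub>R times_i w'))
      (at (complex_of_real t))"
    using T unfolding sector_extension_def by blast
  have "((\<lambda>t. T (complex_of_real t) (x, 0)) has_derivative (\<lambda>h. h *\<^sub>R w')) (at t)"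
    using has_derivative_compose[OF has_derivative_of_real[OF has_derivative_ident] w'] by simp
  then have "((\<lambda>t. fst (T (complex_of_real t) (x, 0))) has_derivative (\<lambda>h. fst (h *\<^sub>R w'))) (at t)"
    by (rule has_derivative_fst)
  then have "((\<lambda>t. fst (T (complex_of_real t) (x, 0))) has_vector_derivative fst w') (at t)"
    by (simp add: has_vector_derivative_def)
  then have d: "((\<lambda>t. S t x) has_vector_derivative fst w') (at t)"
  proof (rule has_vector_derivative_transform_within_open[where S="{0<..}"])
    have "T (complex_of_real s) (x, 0) = (S s x, S s 0)" if "0 < s" for s
      using T that unfolding sector_extension_def by blast
    then show "fst (T (complex_of_real s) (x, 0)) = S s x" if "s \<in> {0<..}" for s
      using that by simp
  qed (use t in auto)
  then have "((\<lambda>h. (S (t + h) x - S t x) /\<^sub>R h) \<longlongrightarrow> fst w') (at_right 0)"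
    by (rule has_vector_derivative_right_quotient)
  then have l: "((\<lambda>h. (S h (S t x) - S t x) /\<^sub>R h) \<longlongrightarrow> fst w') (at_right 0)"
  proof (rule Lim_transform_eventually)
    show "\<forall>\<^sub>F h in at_right 0. (S (t + h) x - S t x) /\<^sub>R h = (S h (S t x) - S t x) /\<^sub>R h"
      using t by (intro eventually_at_rightI[of 0 1]) (simp_all add: S_add add.commute[of t])
  qed
  show "S t x \<in> D" using generator_domain[OF l] .
  show "((\<lambda>t. S t x) has_vector_derivative A (S t x)) (at t)"
    using d generator_eq[OF l] by simp
qed

lemma A_linear: "x \<in> D \<Longrightarrow> y \<in> D \<Longrightarrow> A (x + y) = A x + A y" "x \<in> D \<Longrightarrow> A (c *\<^sub>R x) = c *\<^sub>R A x"
  using selfadj unfolding self_adjoint_def linear_operator_def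
  by (force simp: algebra_simps)+

lemma AS_linear: "0 < s \<Longrightarrow> linear (\<lambda>x. A (S s x))"
  by (intro linearI)
     (auto simp: blinfun.add_right blinfun.scaleR_right A_linear S_has_vector_derivative(1))

lemma A_symmetric: "x \<in> D \<Longrightarrow> y \<in> D \<Longrightarrow> inner (A x) y = inner x (A y)"
  using selfadj unfolding self_adjoint_def by (metis inner_minus_left inner_minus_right neg_equal_iff_equal)

lemma frac_pow_0: "frac_pow S 0 = (\<lambda>x. x)" "frac_dom S 0 = UNIV"
proof -
  have "neg_frac_pow S 0 = (\<lambda>x. x)" by (auto simp: neg_frac_pow_def)
  then show "frac_pow S 0 = (\<lambda>x. x)" "frac_dom S 0 = UNIV"
    by (auto simp: frac_pow_def frac_dom_def inv_def)
qed

lemma S_diff_frac: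
  assumes "0 < h" "\<gamma> \<in> {0..1}" "x \<in> frac_dom S \<gamma>"
  shows "norm (S h x - x) \<le> h powr \<gamma> * norm (frac_pow S \<gamma> x)"
proof -
  have "\<forall>\<theta>\<ge>0. \<forall>\<sigma>\<in>{\<theta>..1 + \<theta>}. \<forall>x\<in>frac_dom S \<sigma>.
     norm (frac_pow S \<theta> (S h x - x)) \<le> h powr (\<sigma> - \<theta>) * norm (frac_pow S \<sigma> x)"
    using est assms(1) unfolding semigroup_estimates_def by blast
  from this[rule_format, of 0 \<gamma> x] show ?thesis using assms(2,3) by (simp add: frac_pow_0)
qed

lemma S_frac:
  assumes "0 < t" "\<gamma> \<in> {0..<1}"
  shows "S t x \<in> frac_dom S \<gamma>" "norm (frac_pow S \<gamma> (S t x)) \<le> t powr - \<gamma> * norm x"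
proof -
  have *: "S t x \<in> frac_dom S \<gamma>" "norm (frac_pow S \<gamma> (S t x)) \<le> t powr - \<gamma> * exp (- lam * t) * norm x"
    using assms est unfolding semigroup_estimates_def by blast+
  have "t powr - \<gamma> * exp (- lam * t) * norm x \<le> t powr - \<gamma> * 1 * norm x"
    using assms lam_pos by (intro mult_right_mono mult_left_mono) auto
  with * show "S t x \<in> frac_dom S \<gamma>" "norm (frac_pow S \<gamma> (S t x)) \<le> t powr - \<gamma> * norm x" by auto
qed

text \<open>The smoothing estimates are available for exponents \<open>\<gamma> < 1\<close> only, and they give the bound
  \<open>(h / t) powr \<gamma> * norm x\<close>. The constants in them do not depend on \<open>\<gamma>\<close>, so one may let \<open>\<gamma>\<close> tend to \<open>1\<close>.\<close>

lemma norm_S_increment: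
  assumes "0 < t" "0 < h"
  shows "norm (S h (S t x) - S t x) \<le> h / t * norm x"
proof -
  have "norm (S h (S t x) - S t x) \<le> (h / t) powr \<gamma> * norm x" if "\<gamma> \<in> {0<..<1}" for \<gamma>
  proof -
    have "norm (S h (S t x) - S t x) \<le> h powr \<gamma> * norm (frac_pow S \<gamma> (S t x))"
      using S_diff_frac[OF assms(2)] S_frac(1)[OF assms(1)] that by auto
    also have "\<dots> \<le> h powr \<gamma> * (t powr - \<gamma> * norm x)"
      using S_frac(2)[OF assms(1)] that by (intro mult_left_mono) auto
    also have "\<dots> = (h / t) powr \<gamma> * norm x"
      using assms by (simp add: powr_divide powr_minus divide_simps)
    finally show ?thesis .
  qed
  then have "\<forall>\<^sub>F \<gamma> in at_left 1. norm (S h (S t x) - S t x) \<le> (h / t) powr \<gamma> * norm x"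
    by (intro eventually_at_leftI[of 0]) auto
  moreover have "((\<lambda>\<gamma>. (h / t) powr \<gamma> * norm x) \<longlongrightarrow> (h / t) powr 1 * norm x) (at_left 1)"
    using assms by (intro tendsto_intros) auto
  ultimately have "norm (S h (S t x) - S t x) \<le> (h / t) powr 1 * norm x"
    by (intro tendsto_lowerbound) auto
  then show ?thesis using assms by simp
qed

lemma norm_AS_le:
  assumes "0 < t"
  shows "norm (A (S t x)) \<le> norm x / t"
proof -
  have "((\<lambda>h. norm ((S h (S t x) - S t x) /\<^sub>R h)) \<longlongrightarrow> norm (A (S t x))) (at_right 0)"
    by (intro tendsto_norm generator_tendsto S_has_vector_derivative assms)
  moreover have "\<forall>\<^sub>F h in at_right 0. norm ((S h (S t x) - S t x) /\<^sub>R h) \<le> norm x / t"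
    using norm_S_increment[OF assms]
    by (intro eventually_at_rightI[of 0 1])
       (auto simp: pos_divide_le_eq inverse_eq_divide mult.commute simp flip: divide_inverse)
  ultimately show ?thesis by (intro tendsto_upperbound) auto
qed

lemma AS_add:
  assumes "0 \<le> s" "0 < t"
  shows "A (S (s + t) x) = S s (A (S t x))"
proof (rule generator_eq)
  have "((\<lambda>h. S s ((S h (S t x) - S t x) /\<^sub>R h)) \<longlongrightarrow> S s (A (S t x))) (at_right 0)"
    by (intro blinfun.tendsto tendsto_const generator_tendsto S_has_vector_derivative assms)
  then show "((\<lambda>h. (S h (S (s + t) x) - S (s + t) x) /\<^sub>R h) \<longlongrightarrow> S s (A (S t x))) (at_right 0)"
  proof (rule Lim_transform_eventually, intro eventually_at_rightI[of 0 1])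
    fix h :: real assume "h \<in> {0<..<1}"
    then have "S h (S s (S t x)) = S s (S h (S t x))"
      using S_add[of h s] S_add[of s h] assms by (simp add: add.commute)
    then show "S s ((S h (S t x) - S t x) /\<^sub>R h) = (S h (S (s + t) x) - S (s + t) x) /\<^sub>R h"
      using assms by (simp add: S_add blinfun.scaleR_right blinfun.diff_right)
  qed simp
qed

text \<open>Near \<open>s > a > 0\<close> one has \<open>A (S s x) = S (s - a) (A (S a x))\<close>, where \<open>A \<circ> S a\<close> is bounded, so continuity is
  inherited from the semigroup.\<close>

lemma AS_joint_continuous: "continuous_on ({0<..} \<times> UNIV) (\<lambda>(s, x). A (S s x))"
proof -
  have *: "continuous_on ({a<..} \<times> UNIV) (\<lambda>(s, x). A (S s x))" if a: "0 < a" for a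
  proof -
    have "bounded_linear (\<lambda>x. A (S a x))"
      using norm_AS_le[OF a] linear_add[OF AS_linear[OF a]] linear_scale[OF AS_linear[OF a]]
      by (intro bounded_linear_intro[where K="1 / a"]) simp_all
    then have "continuous_on ({a<..} \<times> UNIV) (\<lambda>p. S (fst p - a) (A (S a (snd p))))"
      by (intro S_continuous bounded_linear.continuous_on[of "\<lambda>x. A (S a x)"] continuous_intros) auto
    then show ?thesis
    proof (rule continuous_on_eq)
      fix p :: "real \<times> 'h" assume "p \<in> {a<..} \<times> UNIV"
      then have "A (S (fst p) (snd p)) = S (fst p - a) (A (S a (snd p)))"
        using AS_add[of "fst p - a" a "snd p"] a by auto
      then show "S (fst p - a) (A (S a (snd p))) = (case p of (s, x) \<Rightarrow> A (S s x))"
        by (simp add: split_beta)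
    qed
  qed
  have "continuous_on (\<Union>a\<in>{0<..}. {a<..} \<times> (UNIV :: 'h set)) (\<lambda>(s, x). A (S s x))"
    by (rule continuous_on_open_UN) (simp_all add: open_Times *)
  moreover have "(\<Union>a\<in>{0::real<..}. {a<..} \<times> (UNIV :: 'h set)) = {0<..} \<times> UNIV"
  proof (intro equalityI subsetI)
    fix p :: "real \<times> 'h" assume "p \<in> {0<..} \<times> UNIV"
    then show "p \<in> (\<Union>a\<in>{0<..}. {a<..} \<times> UNIV)"
      by (intro UN_I[of "fst p / 2"]) (auto simp: mem_Times_iff)
  qed auto
  ultimately show ?thesis by simp
qed

text \<open>An interpolation argument that avoids any calculus of fractional powers. From
  \<open>A (S s x) = A (S (2 * s) x) - A (S s (S s x - x))\<close>, \<open>norm (A (S s y)) \<le> norm y / s\<close> and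
  \<open>norm (S s x - x) \<le> s powr \<nu> * c\<close>, doubling \<open>s\<close> costs \<open>c * s powr (\<nu> - 1)\<close>. Because \<open>\<nu> < 1\<close>, the costs of
  repeated doubling form a convergent geometric series with ratio \<open>2 powr (\<nu> - 1)\<close>, while the remainder
  \<open>A (S (2 ^ n * s) x)\<close> vanishes in the limit.\<close>

lemma norm_AS_frac_le:
  assumes s: "0 < s" and \<nu>: "0 < \<nu>" "\<nu> < 1" and x: "x \<in> frac_dom S \<nu>"
  shows "norm (A (S s x)) \<le> norm (frac_pow S \<nu> x) / (1 - 2 powr (\<nu> - 1)) * s powr (\<nu> - 1)"
proof -
  define c where "c = norm (frac_pow S \<nu> x)"
  define q where "q = 2 powr (\<nu> - 1)"
  have q: "0 < q" "q < 1" using \<nu> by (auto simp: q_def powr_less_one)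
  have step: "norm (A (S s x)) \<le> norm (A (S (2 * s) x)) + c * s powr (\<nu> - 1)" if "0 < s" for s
  proof -
    have "A (S (2 * s) x) = A (S s x) + A (S s (S s x - x))"
      using linear_diff[OF AS_linear[OF that], of "S s x" x] S_add[of s s x] that by simp
    moreover have "norm (A (S s (S s x - x))) \<le> c * s powr (\<nu> - 1)"
    proof -
      have "norm (A (S s (S s x - x))) \<le> norm (S s x - x) / s" using norm_AS_le[OF that] .
      also have "\<dots> \<le> (s powr \<nu> * c) / s"
        using S_diff_frac[OF that _ x] \<nu> that unfolding c_def by (intro divide_right_mono) auto
      also have "\<dots> = c * s powr (\<nu> - 1)" using that by (simp add: powr_diff)
      finally show ?thesis .
    qed
    ultimately show ?thesis
      using norm_diff_ineq[of "A (S s x)" "A (S s (S s x - x))"] by (smt (verit))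
  qed
  have iter: "norm (A (S s x)) \<le> norm (A (S (2 ^ n * s) x)) + c * s powr (\<nu> - 1) * (\<Sum>k<n. q ^ k)" for n
  proof (induction n)
    case (Suc n)
    have "norm (A (S (2 ^ n * s) x)) \<le> norm (A (S (2 ^ Suc n * s) x)) + c * (2 ^ n * s) powr (\<nu> - 1)"
      using step[of "2 ^ n * s"] s by (simp add: mult.assoc)
    also have "(2 ^ n * s) powr (\<nu> - 1) = q ^ n * s powr (\<nu> - 1)"
    proof -
      have "(2 ^ n :: real) powr (\<nu> - 1) = (2 powr real n) powr (\<nu> - 1)"
        by (subst powr_realpow) simp_all
      also have "\<dots> = q ^ n"
        by (simp only: q_def powr_power[of "2::real", simplified] powr_powr)
      finally have "(2 ^ n :: real) powr (\<nu> - 1) = q ^ n" .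
      then show ?thesis using s by (simp add: powr_mult)
    qed
    finally have "norm (A (S (2 ^ n * s) x))
        \<le> norm (A (S (2 ^ Suc n * s) x)) + c * (q ^ n * s powr (\<nu> - 1))" .
    moreover have "c * s powr (\<nu> - 1) * (\<Sum>k<Suc n. q ^ k)
        = c * s powr (\<nu> - 1) * (\<Sum>k<n. q ^ k) + c * (q ^ n * s powr (\<nu> - 1))"
      by (simp add: distrib_left)
    ultimately show ?case using Suc by linarith
  qed simp
  have "norm (A (S s x)) \<le> norm x / s * (1 / 2) ^ n + c * s powr (\<nu> - 1) * (1 / (1 - q))" for n
  proof -
    have "norm (A (S (2 ^ n * s) x)) \<le> norm x / s * (1 / 2) ^ n"
      using norm_AS_le[of "2 ^ n * s" x] s by (simp add: field_simps power_divide)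
    moreover have "(\<Sum>k<n. q ^ k) \<le> 1 / (1 - q)"
      using q by (simp add: sum_gp_strict divide_right_mono)
    then have "c * s powr (\<nu> - 1) * (\<Sum>k<n. q ^ k) \<le> c * s powr (\<nu> - 1) * (1 / (1 - q))"
      by (intro mult_left_mono) (auto simp: c_def)
    ultimately show ?thesis using iter[of n] by linarith
  qed
  moreover have "(\<lambda>n. norm x / s * (1 / 2) ^ n + c * s powr (\<nu> - 1) * (1 / (1 - q))) \<longlonglongrightarrow>
     norm x / s * 0 + c * s powr (\<nu> - 1) * (1 / (1 - q))"
    by (intro tendsto_intros LIMSEQ_power_zero) auto
  ultimately have "norm (A (S s x)) \<le> norm x / s * 0 + c * s powr (\<nu> - 1) * (1 / (1 - q))"
    by (intro tendsto_lowerbound) auto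
  then show ?thesis by (simp add: c_def q_def field_simps)
qed

text \<open>Since \<open>A\<close> is symmetric, \<open>s \<mapsto> inner (S s x) (S (t - s) y)\<close> has derivative \<open>0\<close> on \<open>(0, t)\<close>. Comparing its
  values at the two endpoints gives the symmetry of \<open>S t\<close>.\<close>

lemma S_symmetric:
  assumes "0 < t"
  shows "inner (S t x) y = inner x (S t y)"
proof -
  let ?f = "\<lambda>s. inner (S s x) (S (t - s) y)"
  have cont: "continuous_on {0..t} ?f"
    by (intro continuous_on_inner S_continuous continuous_intros) auto
  have "(?f has_vector_derivative 0) (at s)" if "s \<in> {0<..<t}" for s
  proof -
    have 1: "((\<lambda>s. S s x) has_derivative (\<lambda>h. h *\<^sub>R A (S s x))) (at s)"
      using S_has_vector_derivative(2)[of s x] that by (simp add: has_vector_derivative_def)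
    have "((\<lambda>s. t - s) has_vector_derivative -1) (at s)"
      by (auto intro!: derivative_eq_intros)
    then have "((\<lambda>s. S (t - s) y) has_vector_derivative (-1) *\<^sub>R A (S (t - s) y)) (at s)"
      using vector_diff_chain_at[of "\<lambda>s. t - s" "-1" s "\<lambda>s. S s y" "A (S (t - s) y)"]
        S_has_vector_derivative(2)[of "t - s" y] that by (simp add: o_def)
    then have 2: "((\<lambda>s. S (t - s) y) has_derivative (\<lambda>h. h *\<^sub>R (- A (S (t - s) y)))) (at s)"
      by (simp add: has_vector_derivative_def)
    have "inner (A (S s x)) (S (t - s) y) = inner (S s x) (A (S (t - s) y))"
      using that by (intro A_symmetric S_has_vector_derivative(1)) auto
    then show ?thesis
      using has_derivative_inner[OF 1 2]
      by (simp add: has_vector_derivative_def algebra_simps inner_add_right)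
  qed
  then have "?f t = ?f 0"
    using cont assms
    by (intro DERIV_isconst_end) (auto simp: has_real_derivative_iff_has_vector_derivative)
  then show ?thesis by (simp add: S_zero)
qed

lemma neg_frac_pow_integrable:
  assumes "0 < \<gamma>"
  shows "set_integrable lborel {0<..} (\<lambda>s. s powr (\<gamma> - 1) *\<^sub>R S s x)"
  unfolding set_integrable_def
proof (rule Bochner_Integration.integrable_bound)
  show "integrable lborel (\<lambda>s. norm x * (indicator {0<..} s *\<^sub>R (s powr (\<gamma> - 1) * exp (- lam * s))))"
    using integrable_powr_exp[OF assms lam_pos] by (simp add: set_integrable_def)
  have "continuous_on {0<..} (\<lambda>s. s powr (\<gamma> - 1) *\<^sub>R S s x)"
    by (intro continuous_intros S_continuous) auto
  then have "(\<lambda>s. indicator {0<..} s *\<^sub>R (s powr (\<gamma> - 1) *\<^sub>R S s x)) \<in> borel_measurable borel"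
    by (intro borel_measurable_continuous_on_indicator) simp
  then show "(\<lambda>s. indicator {0<..} s *\<^sub>R (s powr (\<gamma> - 1) *\<^sub>R S s x)) \<in> borel_measurable lborel"
    by (simp only: measurable_lborel2)
  show "AE s in lborel. norm (indicator {0<..} s *\<^sub>R (s powr (\<gamma> - 1) *\<^sub>R S s x))
    \<le> norm (norm x * (indicator {0<..} s *\<^sub>R (s powr (\<gamma> - 1) * exp (- lam * s))))"
  proof (rule AE_I2)
    fix s
    show "norm (indicator {0<..} s *\<^sub>R (s powr (\<gamma> - 1) *\<^sub>R S s x))
      \<le> norm (norm x * (indicator {0<..} s *\<^sub>R (s powr (\<gamma> - 1) * exp (- lam * s))))"
      using mult_left_mono[OF norm_S_exp[of s x], of "s powr (\<gamma> - 1)"]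
      by (cases "0 < s") (simp_all add: abs_mult mult_ac)
  qed
qed

lemma neg_frac_pow_linear:
  assumes "0 < \<gamma>"
  shows "linear (neg_frac_pow S \<gamma>)"
proof (rule linearI)
  note i = neg_frac_pow_integrable[OF assms]
  show "neg_frac_pow S \<gamma> (x + y) = neg_frac_pow S \<gamma> x + neg_frac_pow S \<gamma> y" for x y
    using set_integral_add(2)[OF i i, of x y] assms
    by (simp add: neg_frac_pow_def blinfun.add_right scaleR_add_right)
  show "neg_frac_pow S \<gamma> (c *\<^sub>R x) = c *\<^sub>R neg_frac_pow S \<gamma> x" for c x
    using set_integral_scaleR_right[of lborel "{0<..}" c "\<lambda>s. s powr (\<gamma> - 1) *\<^sub>R S s x"] assms
    by (simp add: neg_frac_pow_def blinfun.scaleR_right mult.commute)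
qed

text \<open>By symmetry, \<open>inner (S s x) x\<close> is the square of the norm of \<open>S (s / 2) x\<close>.\<close>

lemma inner_neg_frac_pow:
  assumes "0 < \<gamma>"
  shows "set_integrable lborel {0<..} (\<lambda>s. s powr (\<gamma> - 1) * (norm (S (s / 2) x))\<^sup>2)"
    and "inner (neg_frac_pow S \<gamma> x) x
       = (1 / Gamma \<gamma>) * (LINT s:{0<..}|lborel. s powr (\<gamma> - 1) * (norm (S (s / 2) x))\<^sup>2)"
proof -
  have eq: "inner (indicator {0<..} s *\<^sub>R (s powr (\<gamma> - 1) *\<^sub>R S s x)) x
      = indicator {0<..} s *\<^sub>R (s powr (\<gamma> - 1) * (norm (S (s / 2) x))\<^sup>2)" for s :: real
  proof (cases "0 < s")
    case True
    then have "S s x = S (s / 2) (S (s / 2) x)" using S_add[of "s / 2" "s / 2" x] by simp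
    then have "inner (S s x) x = (norm (S (s / 2) x))\<^sup>2"
      using S_symmetric[of "s / 2" "S (s / 2) x" x] True by (simp only: power2_norm_eq_inner)
    then show ?thesis by simp
  qed simp
  have i: "integrable lborel (\<lambda>s. indicator {0<..} s *\<^sub>R (s powr (\<gamma> - 1) *\<^sub>R S s x))"
    using neg_frac_pow_integrable[OF assms] by (simp add: set_integrable_def)
  show "set_integrable lborel {0<..} (\<lambda>s. s powr (\<gamma> - 1) * (norm (S (s / 2) x))\<^sup>2)"
    using integrable_inner_left[of x lborel, OF i] unfolding set_integrable_def eq by blast
  show "inner (neg_frac_pow S \<gamma> x) x
       = (1 / Gamma \<gamma>) * (LINT s:{0<..}|lborel. s powr (\<gamma> - 1) * (norm (S (s / 2) x))\<^sup>2)"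
    using integral_inner_left[of x lborel, OF i] assms
    unfolding set_lebesgue_integral_def eq neg_frac_pow_def by simp
qed

text \<open>If the negative power of \<open>x\<close> vanishes, then so does the integral of the nonnegative function
  \<open>s powr (\<gamma> - 1) * (norm (S (s / 2) x))\<^sup>2\<close>, and \<open>S (s / 2) x = 0\<close> for almost every \<open>s > 0\<close>. As
  \<open>S s x \<rightarrow> x\<close> for \<open>s \<rightarrow> 0\<close>, this forces \<open>x = 0\<close>.\<close>

lemma neg_frac_pow_inj:
  assumes "0 < \<gamma>"
  shows "inj (neg_frac_pow S \<gamma>)"
proof (rule linear_injective_0[OF neg_frac_pow_linear[OF assms], THEN iffD2], intro allI impI)
  fix x assume "neg_frac_pow S \<gamma> x = 0"
  then have "(LINT s:{0<..}|lborel. s powr (\<gamma> - 1) * (norm (S (s / 2) x))\<^sup>2) = 0"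
    using inner_neg_frac_pow(2)[OF assms, of x] Gamma_real_pos[OF assms] by simp
  then have ae: "AE s in lborel. indicator {0<..} s *\<^sub>R (s powr (\<gamma> - 1) * (norm (S (s / 2) x))\<^sup>2) = 0"
    using inner_neg_frac_pow(1)[OF assms, of x]
    unfolding set_lebesgue_integral_def set_integrable_def
    by (subst (asm) integral_nonneg_eq_0_iff_AE) (auto simp: indicator_def)
  show "x = 0"
  proof (rule ccontr)
    assume "x \<noteq> 0"
    then have "\<forall>\<^sub>F s in at_right 0. S s x \<noteq> 0"
      by (rule tendsto_imp_eventually_ne[OF S_tendsto])
    then obtain d where d: "0 < d" "\<And>s. 0 < s \<Longrightarrow> s < d \<Longrightarrow> S s x \<noteq> 0"
      unfolding eventually_at_right_field by auto
    have "AE s in lborel. s \<notin> {0<..<2 * d}"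
      using ae by eventually_elim (use d(2)[of "_ / 2"] in \<open>auto simp: indicator_def\<close>)
    then have "emeasure lborel {0<..<2 * d} = 0"
      by (subst (asm) AE_iff_measurable[of "{0<..<2 * d}"]) auto
    then show False using d(1) by simp
  qed
qed

text \<open>Without injectivity the positive power, the inverse of the negative one, would be an arbitrary choice
  of preimages and need not be additive.\<close>

lemma frac_pow_linear:
  assumes "0 < \<gamma>" "x \<in> frac_dom S \<gamma>" "y \<in> frac_dom S \<gamma>"
  shows "x - y \<in> frac_dom S \<gamma>"
    and "frac_pow S \<gamma> (x - y) = frac_pow S \<gamma> x - frac_pow S \<gamma> y"
proof -
  obtain a b where ab: "x = neg_frac_pow S \<gamma> a" "y = neg_frac_pow S \<gamma> b"
    using assms(2,3) unfolding frac_dom_def by auto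
  then have "x - y = neg_frac_pow S \<gamma> (a - b)"
    by (simp add: linear_diff[OF neg_frac_pow_linear[OF assms(1)]])
  then show "x - y \<in> frac_dom S \<gamma>" "frac_pow S \<gamma> (x - y) = frac_pow S \<gamma> x - frac_pow S \<gamma> y"
    by (auto simp: ab frac_dom_def frac_pow_def inv_f_f[OF neg_frac_pow_inj[OF assms(1)]])
qed

text \<open>The operator norm of a function is a supremum of quotients, and it bounds them only if the function
  is known to be bounded linear. This makes the Lipschitz hypothesis on \<open>G\<close> usable.\<close>

lemma L_frac_diff:
  assumes "0 < \<nu>" "g \<in> L_frac S \<nu>" "g' \<in> L_frac S \<nu>"
  shows "g - g' \<in> L_frac S \<nu>"
proof -
  have "bounded_linear (\<lambda>v. frac_pow S \<nu> (g v) - frac_pow S \<nu> (g' v))"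
    using assms(2,3) by (intro bounded_linear_sub) (auto simp: L_frac_def)
  moreover have "g v \<in> frac_dom S \<nu>" "g' v \<in> frac_dom S \<nu>" for v
    using assms(2,3) by (auto simp: L_frac_def)
  ultimately show ?thesis
    by (auto simp: L_frac_def blinfun.diff_left frac_pow_linear[OF assms(1)])
qed

lemma norm_AS_L_frac_le:
  assumes "0 < s" "0 < \<nu>" "\<nu> < 1" "g \<in> L_frac S \<nu>"
  shows "norm (A (S s (g w))) \<le> norm_L_frac S \<nu> g * norm w / (1 - 2 powr (\<nu> - 1)) * s powr (\<nu> - 1)"
proof -
  have g: "g w \<in> frac_dom S \<nu>" "bounded_linear (\<lambda>v. frac_pow S \<nu> (g v))"
    using assms(4) by (auto simp: L_frac_def)
  have "2 powr (\<nu> - 1) < (1 :: real)" using powr_less_mono[of "\<nu> - 1" 0 2] assms(3) by simp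
  then show ?thesis
    using norm_AS_frac_le[OF assms(1-3) g(1)] onorm[OF g(2), of w] unfolding norm_L_frac_def
    by (elim order_trans) (intro mult_right_mono divide_right_mono, auto)
qed

end

section \<open>The delay equation\<close>

text \<open>The absolute value on the left allows multiplication with constants of unknown sign, such as \<open>L\<^sub>G\<close>.\<close>

lemma norm_seg_bound:
  assumes "0 \<le> \<mu>" "\<And>s. s \<in> {-\<mu>..0} \<Longrightarrow> norm (x s) \<le> c"
  shows "\<bar>norm_seg \<mu> x\<bar> \<le> c"
proof -
  have "norm_seg \<mu> x \<le> c"
    unfolding norm_seg_def using assms by (intro cSUP_least) auto
  moreover have "norm (x 0) \<le> norm_seg \<mu> x"
    unfolding norm_seg_def using assms by (intro cSUP_upper bdd_aboveI2[where M=c]) auto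
  ultimately show ?thesis using norm_ge_zero[of "x 0"] by linarith
qed

lemma seg_diff_bound:
  assumes "0 \<le> \<mu>" "\<And>s. s \<in> {-\<mu>..0} \<Longrightarrow> norm (u (t + s) - v (r + s)) \<le> c"
  shows "\<bar>norm_seg \<mu> (\<lambda>s. seg \<mu> u t s - seg \<mu> v r s)\<bar> \<le> c"
  using assms by (intro norm_seg_bound) (auto simp: seg_def)

lemma seg_in_C_seg:
  assumes "continuous_on {-\<mu>..T} u" "t \<in> {0..T}"
  shows "seg \<mu> u t \<in> C_seg \<mu>"
proof -
  have "continuous_on {-\<mu>..0} (\<lambda>s. u (t + s))"
    using assms(2) by (intro continuous_on_compose2[OF assms(1)] continuous_intros) auto
  then show ?thesis by (auto simp: C_seg_def seg_def intro: continuous_on_eq)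
qed

lemma lipschitz_segE:
  assumes "lipschitz_seg \<mu> F"
  obtains L where "0 \<le> L" "\<And>x y c. x \<in> C_seg \<mu> \<Longrightarrow> y \<in> C_seg \<mu> \<Longrightarrow>
     \<bar>norm_seg \<mu> (\<lambda>s. x s - y s)\<bar> \<le> c \<Longrightarrow> norm (F x - F y) \<le> L * c"
proof -
  obtain L where L: "\<And>x y. x \<in> C_seg \<mu> \<Longrightarrow> y \<in> C_seg \<mu> \<Longrightarrow>
      norm (F x - F y) \<le> L * norm_seg \<mu> (\<lambda>s. x s - y s)"
    using assms unfolding lipschitz_seg_def by blast
  have "L * n \<le> \<bar>L\<bar> * c" if "\<bar>n\<bar> \<le> c" for n c
    using mult_left_mono[OF that, of "\<bar>L\<bar>"] abs_ge_self[of "L * n"] by (simp add: abs_mult)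
  then show thesis using L that[of "\<bar>L\<bar>"] by (meson abs_ge_zero order_trans)
qed

text \<open>Segments of a path move continuously in the sup norm, because the path is uniformly continuous on
  compact intervals.\<close>

lemma lipschitz_seg_continuous:
  assumes lip: "lipschitz_seg \<mu> F" and \<mu>: "0 \<le> \<mu>" and u: "continuous_on {-\<mu>..T} u"
  shows "continuous_on {0..T} (\<lambda>t. F (seg \<mu> u t))"
proof (rule continuous_onI)
  fix t e assume t: "t \<in> {0..T}" and e: "(0 :: real) < e"
  from lip obtain L where L: "0 \<le> L" "\<And>x y c. x \<in> C_seg \<mu> \<Longrightarrow> y \<in> C_seg \<mu> \<Longrightarrow>
     \<bar>norm_seg \<mu> (\<lambda>s. x s - y s)\<bar> \<le> c \<Longrightarrow> norm (F x - F y) \<le> L * c"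
    by (rule lipschitz_segE) blast
  define e' where "e' = e / (L + 1)"
  have e': "0 < e'" using e L by (simp add: e'_def)
  have "uniformly_continuous_on {-\<mu>..T} u"
    using u by (intro compact_uniformly_continuous) auto
  then obtain d where d: "0 < d" "\<And>r r'. r \<in> {-\<mu>..T} \<Longrightarrow> r' \<in> {-\<mu>..T} \<Longrightarrow> dist r' r < d \<Longrightarrow> dist (u r') (u r) < e'"
    using e' unfolding uniformly_continuous_on_def by metis
  have "dist (F (seg \<mu> u r)) (F (seg \<mu> u t)) \<le> e" if r: "r \<in> {0..T}" "dist r t < d" for r
  proof -
    have "norm (F (seg \<mu> u r) - F (seg \<mu> u t)) \<le> L * e'"
    proof (intro L seg_in_C_seg[OF u] seg_diff_bound \<mu>)
      fix s assume "s \<in> {-\<mu>..0}"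
      then show "norm (u (r + s) - u (t + s)) \<le> e'"
        using d(2)[of "t + s" "r + s"] r t by (auto simp: dist_norm)
    qed (use r t in auto)
    also have "\<dots> \<le> e" using e L by (simp add: e'_def field_simps)
    finally show ?thesis by (simp add: dist_norm)
  qed
  then show "\<exists>d>0. \<forall>x'\<in>{0..T}. dist x' t < d \<longrightarrow> dist (F (seg \<mu> u x')) (F (seg \<mu> u t)) \<le> e"
    using d(1) by blast
qed

locale delay_equation = parabolic_semigroup D A S lam
  for D :: "'h::{real_inner, banach, second_countable_topology} set" and A S lam +
  fixes F :: "(real \<Rightarrow> 'h) \<Rightarrow> 'h"
    and G K :: "(real \<Rightarrow> 'h) \<Rightarrow> ('u::real_normed_vector \<Rightarrow>\<^sub>L 'h)"
    and \<mu> \<nu> L\<^sub>G :: real and \<xi> :: "real \<Rightarrow> 'h" and \<omega> :: "real \<Rightarrow> 'u"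
  assumes mu_pos: "0 < \<mu>"
    and F_lip: "lipschitz_seg \<mu> F"
    and nu: "0 < \<nu>" "\<nu> < 1"
    and G_L_frac: "\<And>x. x \<in> C_seg \<mu> \<Longrightarrow> G x \<in> L_frac S \<nu>"
    and G_lip: "\<And>x y. x \<in> C_seg \<mu> \<Longrightarrow> y \<in> C_seg \<mu> \<Longrightarrow>
       norm_L_frac S \<nu> (G x - G y) \<le> L\<^sub>G * norm_seg \<mu> (\<lambda>s. x s - y s)"
    and K_lip: "lipschitz_seg \<mu> K"
    and G_diff: "\<And>T u. 0 < T \<Longrightarrow> continuous_on {-\<mu>..T} u \<Longrightarrow>
       (\<forall>t\<in>{0..T}. ((\<lambda>t. G (seg \<mu> u t)) has_vector_derivative K (seg \<mu> u t)) (at t within {0..T}))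
       \<and> continuous_on {0..T} (\<lambda>t. K (seg \<mu> u t))"
    and xi: "\<xi> \<in> C_seg \<mu>"
    and noise_cont: "continuous_on UNIV \<omega>" and noise_0: "\<omega> 0 = 0"
begin

definition admissible :: "(real \<Rightarrow> 'h) set" where
  "admissible = {u \<in> extensional {-\<mu>..}. continuous_on {-\<mu>..} u \<and> (\<forall>t\<in>{-\<mu>..0}. u t = \<xi> t)}"

definition variation_of_constants :: "(real \<Rightarrow> 'h) \<Rightarrow> real \<Rightarrow> 'h" where
  "variation_of_constants u t = S t (\<xi> 0)
     + (LINT r:{0..t}|lborel. S (t - r) (F (seg \<mu> u r)))
     + (LINT r:{0..t}|lborel. A (S (t - r) (G (seg \<mu> u r) (\<omega> r))))
     + G (seg \<mu> u t) (\<omega> t)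
     - (LINT r:{0..t}|lborel. S (t - r) (K (seg \<mu> u r) (\<omega> r)))"

text \<open>Prescribing \<open>\<xi>\<close> on the initial interval and restricting to \<open>[-\<mu>, \<infinity>)\<close> turns the equation for \<open>t \<ge> 0\<close>, the initial
  condition and extensionality into the one equation \<open>solution_map u = u\<close>.\<close>

definition solution_map :: "(real \<Rightarrow> 'h) \<Rightarrow> real \<Rightarrow> 'h" where
  "solution_map u = restrict (\<lambda>t. if t \<le> 0 then \<xi> t else variation_of_constants u t) {-\<mu>..}"

lemma glue_admissible:
  assumes "continuous_on {0..} g" "g 0 = \<xi> 0"
  shows "(\<lambda>t\<in>{-\<mu>..}. if t \<le> 0 then \<xi> t else g t) \<in> admissible"
proof -
  have "continuous_on ({-\<mu>..0} \<union> {0..}) (\<lambda>t. if t \<le> 0 then \<xi> t else g t)"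
    using xi assms by (intro continuous_on_If) (auto simp: C_seg_def dest: order.antisym)
  moreover have "{-\<mu>..0} \<union> {0..} = {-\<mu>..}" using mu_pos by auto
  ultimately have "continuous_on {-\<mu>..} (\<lambda>t. if t \<le> 0 then \<xi> t else g t)" by simp
  then have "continuous_on {-\<mu>..} (\<lambda>t\<in>{-\<mu>..}. if t \<le> 0 then \<xi> t else g t)"
    by (rule continuous_on_eq) simp
  then show ?thesis by (simp add: admissible_def)
qed

lemma admissible_continuous: "u \<in> admissible \<Longrightarrow> continuous_on {-\<mu>..T} u"
  by (auto simp: admissible_def elim: continuous_on_subset)

lemma noise_bound:
  obtains W where "0 \<le> W" "\<And>r. r \<in> {0..T} \<Longrightarrow> norm (\<omega> r) \<le> W"
proof -
  have "continuous_on {0..T} \<omega>" by (rule continuous_on_subset[OF noise_cont]) simp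
  then have "bounded (\<omega> ` {0..T})"
    by (intro compact_imp_bounded compact_continuous_image) auto
  then obtain W where "\<And>r. r \<in> {0..T} \<Longrightarrow> norm (\<omega> r) \<le> W"
    unfolding bounded_iff by force
  then show thesis by (intro that[of "\<bar>W\<bar>"]) force+
qed

lemma convolution_terms:
  assumes "0 < T" "continuous_on {0..T} f"
  shows S_convolution_integrable: "t \<in> {0..T} \<Longrightarrow> set_integrable lborel {0..t} (\<lambda>r. S (t - r) (f r))"
    and S_convolution_continuous: "continuous_on {0..T} (\<lambda>t. LINT r:{0..t}|lborel. S (t - r) (f r))"
proof -
  have "bounded (f ` {0..T})"
    using assms by (intro compact_imp_bounded compact_continuous_image) auto
  then obtain M where M: "\<And>r. r \<in> {0..T} \<Longrightarrow> norm (f r) \<le> M"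
    unfolding bounded_iff by force
  have bound: "norm (S s (f r)) \<le> M * s powr (1 - 1)" if "s \<in> {0<..T}" "r \<in> {0..T}" for s r
    using norm_S_le[of s "f r"] M[of r] that by auto
  have P: "continuous_on ({0<..} \<times> UNIV) (\<lambda>(s, x). S s x)"
    by (rule continuous_on_subset[OF S_joint_continuous]) auto
  note * = continuous_on_weakly_singular_convolution[OF zero_less_one P assms(2) bound]
  show "t \<in> {0..T} \<Longrightarrow> set_integrable lborel {0..t} (\<lambda>r. S (t - r) (f r))" by (rule *)
  show "continuous_on {0..T} (\<lambda>t. LINT r:{0..t}|lborel. S (t - r) (f r))" by (rule *)
qed

lemma S_convolution_diff_le:
  assumes "0 < T" "continuous_on {0..T} f" "continuous_on {0..T} g" "0 \<le> \<rho>" "0 \<le> M" "t \<in> {0..T}"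
    and "\<And>r. r \<in> {0..T} \<Longrightarrow> norm (f r - g r) \<le> M * exp (\<rho> * r)"
  shows "norm ((LINT r:{0..t}|lborel. S (t - r) (f r)) - (LINT r:{0..t}|lborel. S (t - r) (g r)))
       \<le> M * damped_mass 1 \<rho> T * exp (\<rho> * t)"
proof (intro weakly_singular_integral_diff_le S_convolution_integrable[OF assms(1)] assms)
  fix r assume r: "0 \<le> r" "r < t"
  have "norm (S (t - r) (f r) - S (t - r) (g r)) \<le> norm (f r - g r)"
    using norm_S_le[of "t - r" "f r - g r"] r by (simp add: blinfun.diff_right)
  also have "\<dots> \<le> M * exp (\<rho> * r)" using assms(6) r by (intro assms(7)) auto
  finally show "norm (S (t - r) (f r) - S (t - r) (g r)) \<le> M * (t - r) powr (1 - 1) * exp (\<rho> * r)"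
    using r by simp
qed simp

text \<open>Up to the factor \<open>s powr (\<nu> - 1)\<close>, a Lipschitz constant of \<open>x \<mapsto> A \<circ> S s \<circ> G x\<close>; the denominator comes from
  \<open>norm_AS_frac_le\<close>.\<close>

definition AG_const :: real where "AG_const = \<bar>L\<^sub>G\<bar> / (1 - 2 powr (\<nu> - 1))"

lemma singular_factor_pos: "0 < 1 - 2 powr (\<nu> - 1)"
  using powr_less_mono[of "\<nu> - 1" 0 2] nu by simp

lemma AG_const_nonneg: "0 \<le> AG_const"
  using singular_factor_pos by (simp add: AG_const_def)

lemma norm_AS_G_diff_le:
  assumes "0 < s" "x \<in> C_seg \<mu>" "y \<in> C_seg \<mu>" "\<bar>norm_seg \<mu> (\<lambda>s. x s - y s)\<bar> \<le> c"
  shows "norm (A (S s (G x w)) - A (S s (G y w))) \<le> AG_const * c * norm w * s powr (\<nu> - 1)"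
proof -
  have "L\<^sub>G * norm_seg \<mu> (\<lambda>s. x s - y s) \<le> \<bar>L\<^sub>G\<bar> * \<bar>norm_seg \<mu> (\<lambda>s. x s - y s)\<bar>"
    using abs_ge_self by (simp flip: abs_mult)
  also have "\<dots> \<le> \<bar>L\<^sub>G\<bar> * c" using assms(4) by (intro mult_left_mono) auto
  finally have n: "norm_L_frac S \<nu> (G x - G y) \<le> \<bar>L\<^sub>G\<bar> * c"
    using G_lip[OF assms(2,3)] by simp
  have "norm (A (S s ((G x - G y) w)))
     \<le> norm_L_frac S \<nu> (G x - G y) * norm w / (1 - 2 powr (\<nu> - 1)) * s powr (\<nu> - 1)"
    using assms by (intro norm_AS_L_frac_le L_frac_diff G_L_frac nu)
  also have "\<dots> \<le> (\<bar>L\<^sub>G\<bar> * c) * norm w / (1 - 2 powr (\<nu> - 1)) * s powr (\<nu> - 1)"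
    using n singular_factor_pos by (intro mult_right_mono divide_right_mono) auto
  finally show ?thesis
    using linear_diff[OF AS_linear[OF assms(1)], of "G x w" "G y w"]
    by (simp add: blinfun.diff_left AG_const_def)
qed

lemma G_seg_continuous:
  assumes "u \<in> admissible" "0 < T"
  shows "continuous_on {0..T} (\<lambda>t. G (seg \<mu> u t))"
  unfolding continuous_on_eq_continuous_within
  using G_diff[OF assms(2) admissible_continuous[OF assms(1)]]
  by (blast intro: has_vector_derivative_continuous)

lemma noise_term_continuous:
  fixes B :: "real \<Rightarrow> 'u \<Rightarrow>\<^sub>L 'h"
  assumes "continuous_on {0..T} B"
  shows "continuous_on {0..T} (\<lambda>t. B t (\<omega> t))"
  using assms by (intro continuous_intros continuous_on_subset[OF noise_cont]) auto

text \<open>Along a path the segments stay in a bounded set, so the Lipschitz condition bounds \<open>G (u\<^sub>r)\<close> in terms of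
  \<open>G \<xi>\<close>, uniformly for \<open>r\<close> in \<open>[0, T]\<close>.\<close>

lemma AG_bound:
  assumes u: "u \<in> admissible" and T: "0 < T"
  obtains M where "\<And>s r. s \<in> {0<..T} \<Longrightarrow> r \<in> {0..T} \<Longrightarrow>
     norm (A (S s (G (seg \<mu> u r) (\<omega> r)))) \<le> M * s powr (\<nu> - 1)"
proof -
  have cont: "continuous_on {-\<mu>..T} u" by (rule admissible_continuous[OF u])
  then have "bounded (u ` {-\<mu>..T})"
    by (intro compact_imp_bounded compact_continuous_image) auto
  then obtain B where B: "\<And>r. r \<in> {-\<mu>..T} \<Longrightarrow> norm (u r) \<le> B"
    unfolding bounded_iff by force
  obtain W where W: "0 \<le> W" "\<And>r. r \<in> {0..T} \<Longrightarrow> norm (\<omega> r) \<le> W"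
    using noise_bound[of T] by blast
  define N where "N = \<bar>norm_L_frac S \<nu> (G \<xi>)\<bar> / (1 - 2 powr (\<nu> - 1))"
  have B0: "0 \<le> B" using order_trans[OF norm_ge_zero B[of 0]] mu_pos T by simp
  have "norm (A (S s (G (seg \<mu> u r) (\<omega> r)))) \<le> (AG_const * (2 * B) * W + N * W) * s powr (\<nu> - 1)"
    if s: "s \<in> {0<..T}" and r: "r \<in> {0..T}" for s r
  proof -
    let ?x = "seg \<mu> u r"
    have x: "?x \<in> C_seg \<mu>" using cont r by (rule seg_in_C_seg)
    have "norm (?x s - \<xi> s) \<le> 2 * B" if "s \<in> {-\<mu>..0}" for s
      using B[of "r + s"] B[of s] that r u norm_triangle_ineq4[of "u (r + s)" "u s"]
      by (auto simp: seg_def admissible_def)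
    then have "norm (A (S s (G ?x (\<omega> r))) - A (S s (G \<xi> (\<omega> r))))
        \<le> AG_const * (2 * B) * norm (\<omega> r) * s powr (\<nu> - 1)"
      using mu_pos s by (intro norm_AS_G_diff_le x xi norm_seg_bound) auto
    also have "\<dots> \<le> AG_const * (2 * B) * W * s powr (\<nu> - 1)"
      using W(2)[OF r] AG_const_nonneg B0 by (intro mult_right_mono mult_left_mono) auto
    finally have 1: "norm (A (S s (G ?x (\<omega> r))) - A (S s (G \<xi> (\<omega> r))))
        \<le> AG_const * (2 * B) * W * s powr (\<nu> - 1)" .
    have "norm (A (S s (G \<xi> (\<omega> r))))
        \<le> norm_L_frac S \<nu> (G \<xi>) * norm (\<omega> r) / (1 - 2 powr (\<nu> - 1)) * s powr (\<nu> - 1)"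
      using s by (intro norm_AS_L_frac_le nu G_L_frac xi) auto
    also have "\<dots> \<le> \<bar>norm_L_frac S \<nu> (G \<xi>)\<bar> * W / (1 - 2 powr (\<nu> - 1)) * s powr (\<nu> - 1)"
      using W(2)[OF r] singular_factor_pos
      by (intro mult_right_mono divide_right_mono mult_mono) auto
    also have "\<dots> = N * W * s powr (\<nu> - 1)" by (simp add: N_def)
    finally show ?thesis
      using 1 norm_triangle_sub[of "A (S s (G ?x (\<omega> r)))" "A (S s (G \<xi> (\<omega> r)))"]
      by (simp add: distrib_right)
  qed
  then show thesis by (rule that)
qed

lemma AG_convolution:
  assumes u: "u \<in> admissible" and T: "0 < T"
  shows "t \<in> {0..T} \<Longrightarrow> set_integrable lborel {0..t} (\<lambda>r. A (S (t - r) (G (seg \<mu> u r) (\<omega> r))))"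
    and "continuous_on {0..T} (\<lambda>t. LINT r:{0..t}|lborel. A (S (t - r) (G (seg \<mu> u r) (\<omega> r))))"
proof -
  obtain M where M: "\<And>s r. s \<in> {0<..T} \<Longrightarrow> r \<in> {0..T} \<Longrightarrow>
     norm (A (S s (G (seg \<mu> u r) (\<omega> r)))) \<le> M * s powr (\<nu> - 1)"
    using AG_bound[OF u T] by blast
  note * = continuous_on_weakly_singular_convolution[OF nu(1) AS_joint_continuous
      noise_term_continuous[OF G_seg_continuous[OF u T]] M]
  show "t \<in> {0..T} \<Longrightarrow> set_integrable lborel {0..t} (\<lambda>r. A (S (t - r) (G (seg \<mu> u r) (\<omega> r))))"
    by (rule *)
  show "continuous_on {0..T} (\<lambda>t. LINT r:{0..t}|lborel. A (S (t - r) (G (seg \<mu> u r) (\<omega> r))))"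
    by (rule *)
qed

lemma F_seg_continuous: "u \<in> admissible \<Longrightarrow> continuous_on {0..T} (\<lambda>t. F (seg \<mu> u t))"
  using mu_pos by (intro lipschitz_seg_continuous[OF F_lip] admissible_continuous) auto

lemma K_term_continuous: "u \<in> admissible \<Longrightarrow> continuous_on {0..T} (\<lambda>t. K (seg \<mu> u t) (\<omega> t))"
  using mu_pos by (intro noise_term_continuous lipschitz_seg_continuous[OF K_lip] admissible_continuous) auto

lemma set_integral_singleton: "(LINT r:{a..a::real}|lborel. f r) = 0"
proof -
  have "AE r in lborel. indicator {a} r *\<^sub>R f r = 0"
    using AE_lborel_singleton[of a] by eventually_elim auto
  then show ?thesis by (simp add: set_lebesgue_integral_def integral_eq_zero_AE)
qed

lemma variation_of_constants_0: "variation_of_constants u 0 = \<xi> 0"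
  by (simp add: variation_of_constants_def set_integral_singleton noise_0 S_zero del: atLeastAtMost_singleton)

lemma solution_map_admissible:
  assumes u: "u \<in> admissible"
  shows "solution_map u \<in> admissible"
proof -
  have "continuous_on {0..} (variation_of_constants u)"
  proof (rule continuous_on_atLeastI[of 0])
    fix T :: real assume T: "0 < T"
    have "continuous_on {0..T} (\<lambda>t. S t (\<xi> 0))"
      by (rule S_continuous) (auto intro: continuous_on_id)
    moreover note S_convolution_continuous[OF T F_seg_continuous[OF u]] AG_convolution(2)[OF u T]
      noise_term_continuous[OF G_seg_continuous[OF u T]]
      S_convolution_continuous[OF T K_term_continuous[OF u]]
    ultimately show "continuous_on {0..T} (variation_of_constants u)"
      unfolding variation_of_constants_def by (intro continuous_on_add continuous_on_diff)
  qed
  then show ?thesis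
    unfolding solution_map_def by (rule glue_admissible) (rule variation_of_constants_0)
qed

lemma global_mild_solution_iff:
  "global_mild_solution \<mu> A S F G K \<xi> \<omega> u \<longleftrightarrow> u \<in> admissible \<and> solution_map u = u"
proof
  assume g: "global_mild_solution \<mu> A S F G K \<xi> \<omega> u"
  then have u: "u \<in> admissible" by (simp add: admissible_def global_mild_solution_def)
  have voc: "u t = variation_of_constants u t" if "0 \<le> t" for t
    using g that unfolding global_mild_solution_def variation_of_constants_def by blast
  have "solution_map u t = u t" for t
    using u voc[of t] by (auto simp: solution_map_def admissible_def extensional_def)
  then show "u \<in> admissible \<and> solution_map u = u" using u by blast
next
  assume "u \<in> admissible \<and> solution_map u = u"
  then have u: "u \<in> admissible" and fixed: "\<And>t. solution_map u t = u t" by auto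
  have "u t = variation_of_constants u t" if "0 \<le> t" for t
  proof (cases "t = 0")
    case True
    then show ?thesis using u mu_pos by (simp add: variation_of_constants_0 admissible_def)
  next
    case False
    then show ?thesis using fixed[of t] that mu_pos by (simp add: solution_map_def)
  qed
  moreover have "set_integrable lborel {0..t} (\<lambda>r. S (t - r) (F (seg \<mu> u r)))"
    "set_integrable lborel {0..t} (\<lambda>r. A (S (t - r) (G (seg \<mu> u r) (\<omega> r))))"
    "set_integrable lborel {0..t} (\<lambda>r. S (t - r) (K (seg \<mu> u r) (\<omega> r)))" if "0 \<le> t" for t
    using that by (auto intro!: S_convolution_integrable[of "t + 1"] AG_convolution(1)[OF u, of "t + 1"]
       F_seg_continuous K_term_continuous u)
  ultimately show "global_mild_solution \<mu> A S F G K \<xi> \<omega> u"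
    using u unfolding global_mild_solution_def admissible_def variation_of_constants_def by blast
qed

text \<open>The point of the hypothesis on \<open>K\<close>: the difference of \<open>G (u\<^sub>t)\<close> and \<open>G (v\<^sub>t)\<close> starts at \<open>0\<close>, since \<open>u\<close> and \<open>v\<close>
  agree on \<open>[-\<mu>, 0]\<close>, and grows with velocity \<open>K (u\<^sub>r) - K (v\<^sub>r)\<close>. Integrating the exponential bound gains
  the factor \<open>1 / \<rho>\<close>.\<close>

lemma norm_G_seg_diff_le:
  assumes u: "u \<in> admissible" and v: "v \<in> admissible" and t: "0 \<le> t" and \<rho>: "0 < \<rho>" and M: "0 \<le> M"
    and K: "\<And>r. r \<in> {0..t} \<Longrightarrow> norm (K (seg \<mu> u r) - K (seg \<mu> v r)) \<le> M * exp (\<rho> * r)"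
  shows "norm (G (seg \<mu> u t) - G (seg \<mu> v t)) \<le> M / \<rho> * exp (\<rho> * t)"
proof -
  have "seg \<mu> u 0 = seg \<mu> v 0"
    using u v by (auto simp: seg_def admissible_def restrict_def fun_eq_iff)
  then have zero: "G (seg \<mu> u 0) - G (seg \<mu> v 0) = 0" by simp
  show ?thesis
  proof (cases "t = 0")
    case True
    then show ?thesis using zero M \<rho> by simp
  next
    case False
    then have t: "0 < t" using t by simp
    have "norm ((G (seg \<mu> u t) - G (seg \<mu> v t)) - (G (seg \<mu> u 0) - G (seg \<mu> v 0)))
        \<le> M / \<rho> * exp (\<rho> * t) - M / \<rho> * exp (\<rho> * 0)"
    proof (rule differentiable_bound_general[OF t])
      show "continuous_on {0..t} (\<lambda>t. G (seg \<mu> u t) - G (seg \<mu> v t))"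
        by (intro continuous_on_diff G_seg_continuous u v t)
      show "continuous_on {0..t} (\<lambda>t. M / \<rho> * exp (\<rho> * t))"
        by (intro continuous_intros)
      fix r assume r: "0 < r" "r < t"
      have "((\<lambda>t. G (seg \<mu> w t)) has_vector_derivative K (seg \<mu> w r)) (at r)" if "w \<in> admissible" for w
      proof -
        have "((\<lambda>t. G (seg \<mu> w t)) has_vector_derivative K (seg \<mu> w r)) (at r within {0..t})"
          using G_diff[OF t admissible_continuous[OF that]] r by auto
        then show ?thesis by (simp only: at_within_Icc_at[OF r])
      qed
      from has_vector_derivative_diff[OF this[OF u] this[OF v]]
      show "((\<lambda>t. G (seg \<mu> u t) - G (seg \<mu> v t)) has_vector_derivative
          K (seg \<mu> u r) - K (seg \<mu> v r)) (at r)" .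
      show "((\<lambda>t. M / \<rho> * exp (\<rho> * t)) has_vector_derivative M * exp (\<rho> * r)) (at r)"
        using \<rho> unfolding has_real_derivative_iff_has_vector_derivative[symmetric]
        by (auto intro!: derivative_eq_intros)
      show "norm (K (seg \<mu> u r) - K (seg \<mu> v r)) \<le> M * exp (\<rho> * r)"
        using r by (intro K) auto
    qed
    moreover have "0 \<le> M / \<rho> * exp (\<rho> * 0)" using M \<rho> by simp
    ultimately show ?thesis unfolding zero by simp
  qed
qed

text \<open>Each of the four terms that depend on \<open>u\<close> carries a factor that vanishes as \<open>\<rho> \<rightarrow> \<infinity>\<close>, so a large \<open>\<rho>\<close> makes
  their sum \<open>q \<rho>\<close> less than \<open>1\<close>.\<close>

lemma solution_map_contraction:
  assumes T: "0 < T"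
  shows "\<exists>\<rho>\<ge>0. \<exists>q\<in>{0..<1}. \<forall>u\<in>admissible. \<forall>v\<in>admissible. \<forall>m\<ge>0.
       (\<forall>t\<in>{0..T}. norm (u t - v t) \<le> m * exp (\<rho> * t)) \<longrightarrow>
       (\<forall>t\<in>{0..T}. norm (solution_map u t - solution_map v t) \<le> q * m * exp (\<rho> * t))"
proof -
  from F_lip obtain LF where LF: "0 \<le> LF" "\<And>x y c. x \<in> C_seg \<mu> \<Longrightarrow> y \<in> C_seg \<mu> \<Longrightarrow>
     \<bar>norm_seg \<mu> (\<lambda>s. x s - y s)\<bar> \<le> c \<Longrightarrow> norm (F x - F y) \<le> LF * c"
    by (rule lipschitz_segE) blast
  from K_lip obtain LK where LK: "0 \<le> LK" "\<And>x y c. x \<in> C_seg \<mu> \<Longrightarrow> y \<in> C_seg \<mu> \<Longrightarrow>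
     \<bar>norm_seg \<mu> (\<lambda>s. x s - y s)\<bar> \<le> c \<Longrightarrow> norm (K x - K y) \<le> LK * c"
    by (rule lipschitz_segE) blast
  obtain W where W: "0 \<le> W" "\<And>r. r \<in> {0..T} \<Longrightarrow> norm (\<omega> r) \<le> W"
    using noise_bound[of T] by blast
  define q where "q \<rho> = LF * damped_mass 1 \<rho> T + AG_const * W * damped_mass \<nu> \<rho> T
     + LK * W * (1 / \<rho>) + LK * W * damped_mass 1 \<rho> T" for \<rho>
  have "((\<lambda>\<rho>::real. 1 / \<rho>) \<longlongrightarrow> 0) at_top" by real_asymp
  then have "(q \<longlongrightarrow> LF * 0 + AG_const * W * 0 + LK * W * 0 + LK * W * 0) at_top"
    unfolding q_def by (intro tendsto_intros damped_mass_tendsto_0 nu) auto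
  then have "\<forall>\<^sub>F \<rho> in at_top. q \<rho> < 1 \<and> 0 < \<rho>"
    by (intro eventually_conj eventually_gt_at_top order_tendstoD(2)[of q 0]) auto
  then obtain \<rho> where \<rho>: "q \<rho> < 1" "0 < \<rho>"
    using eventually_happens[of _ "at_top :: real filter"] by auto
  have "norm (solution_map u t - solution_map v t) \<le> q \<rho> * m * exp (\<rho> * t)"
    if u: "u \<in> admissible" and v: "v \<in> admissible" and m: "0 \<le> m"
      and uv: "\<forall>t\<in>{0..T}. norm (u t - v t) \<le> m * exp (\<rho> * t)" and t: "t \<in> {0..T}" for u v m t
  proof -
    have seg: "\<bar>norm_seg \<mu> (\<lambda>s. seg \<mu> u r s - seg \<mu> v r s)\<bar> \<le> m * exp (\<rho> * r)" if r: "r \<in> {0..T}" for r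
    proof (rule seg_diff_bound)
      fix s assume s: "s \<in> {-\<mu>..0}"
      \<comment> \<open>The weight is increasing, so looking back in time does not worsen the bound.\<close>
      show "norm (u (r + s) - v (r + s)) \<le> m * exp (\<rho> * r)"
      proof (cases "0 \<le> r + s")
        case True
        then have "norm (u (r + s) - v (r + s)) \<le> m * exp (\<rho> * (r + s))" using uv r s by auto
        also have "\<dots> \<le> m * exp (\<rho> * r)" using m \<rho> s by (intro mult_left_mono) auto
        finally show ?thesis .
      next
        case False
        then show ?thesis using u v r s m by (auto simp: admissible_def)
      qed
    qed (use mu_pos in simp)
    have C: "seg \<mu> w r \<in> C_seg \<mu>" if "w \<in> admissible" "r \<in> {0..T}" for w r
      using seg_in_C_seg[OF admissible_continuous[OF that(1)] that(2)] .
    have dF: "norm (F (seg \<mu> u r) - F (seg \<mu> v r)) \<le> LF * m * exp (\<rho> * r)" if "r \<in> {0..T}" for r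
      using LF(2)[OF C[OF u that] C[OF v that] seg[OF that]] by (simp add: mult.assoc)
    have dK: "norm (K (seg \<mu> u r) - K (seg \<mu> v r)) \<le> LK * m * exp (\<rho> * r)" if "r \<in> {0..T}" for r
      using LK(2)[OF C[OF u that] C[OF v that] seg[OF that]] by (simp add: mult.assoc)
    have noise: "norm (B (\<omega> r) - B' (\<omega> r)) \<le> c * W" if "norm (B - B') \<le> c" "r \<in> {0..T}" for B B' :: "'u \<Rightarrow>\<^sub>L 'h" and c r
    proof -
      have "norm (B (\<omega> r) - B' (\<omega> r)) \<le> norm (B - B') * norm (\<omega> r)"
        using norm_blinfun[of "B - B'" "\<omega> r"] by (simp add: blinfun.diff_left)
      also have "\<dots> \<le> c * W"
        using that W by (intro mult_mono) (auto intro: order_trans[OF norm_ge_zero])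
      finally show ?thesis .
    qed
    have 1: "norm ((LINT r:{0..t}|lborel. S (t - r) (F (seg \<mu> u r))) - (LINT r:{0..t}|lborel. S (t - r) (F (seg \<mu> v r))))
        \<le> LF * m * damped_mass 1 \<rho> T * exp (\<rho> * t)"
      using dF LF m \<rho> t by (intro S_convolution_diff_le[OF T] F_seg_continuous u v) auto
    have 2: "norm ((LINT r:{0..t}|lborel. A (S (t - r) (G (seg \<mu> u r) (\<omega> r))))
          - (LINT r:{0..t}|lborel. A (S (t - r) (G (seg \<mu> v r) (\<omega> r)))))
        \<le> AG_const * W * m * damped_mass \<nu> \<rho> T * exp (\<rho> * t)"
    proof (intro weakly_singular_integral_diff_le nu t AG_convolution(1)[OF _ T] u v)
      fix r assume r: "0 \<le> r" "r < t"
      then have r': "r \<in> {0..T}" using t by auto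
      have "norm (A (S (t - r) (G (seg \<mu> u r) (\<omega> r))) - A (S (t - r) (G (seg \<mu> v r) (\<omega> r))))
          \<le> AG_const * (m * exp (\<rho> * r)) * norm (\<omega> r) * (t - r) powr (\<nu> - 1)"
        using r by (intro norm_AS_G_diff_le C u v r' seg) auto
      also have "\<dots> \<le> AG_const * (m * exp (\<rho> * r)) * W * (t - r) powr (\<nu> - 1)"
        using W(2)[OF r'] m AG_const_nonneg by (intro mult_right_mono mult_left_mono) auto
      finally show "norm (A (S (t - r) (G (seg \<mu> u r) (\<omega> r))) - A (S (t - r) (G (seg \<mu> v r) (\<omega> r))))
          \<le> AG_const * W * m * (t - r) powr (\<nu> - 1) * exp (\<rho> * r)"
        by (simp add: mult_ac)
    qed (use \<rho> m W AG_const_nonneg in auto)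
    have "norm (G (seg \<mu> u t) - G (seg \<mu> v t)) \<le> LK * m / \<rho> * exp (\<rho> * t)"
      using t dK LK m \<rho> by (intro norm_G_seg_diff_le u v) auto
    from noise[OF this t]
    have 3: "norm (G (seg \<mu> u t) (\<omega> t) - G (seg \<mu> v t) (\<omega> t)) \<le> LK * m / \<rho> * exp (\<rho> * t) * W" .
    have 4: "norm ((LINT r:{0..t}|lborel. S (t - r) (K (seg \<mu> u r) (\<omega> r)))
          - (LINT r:{0..t}|lborel. S (t - r) (K (seg \<mu> v r) (\<omega> r))))
        \<le> LK * m * W * damped_mass 1 \<rho> T * exp (\<rho> * t)"
    proof (intro S_convolution_diff_le[OF T] K_term_continuous u v t)
      fix r assume r: "r \<in> {0..T}"
      show "norm (K (seg \<mu> u r) (\<omega> r) - K (seg \<mu> v r) (\<omega> r)) \<le> LK * m * W * exp (\<rho> * r)"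
        using noise[OF dK[OF r] r] by (simp add: mult_ac)
    qed (use LK m W \<rho> in auto)
    have tri: "norm ((a + b + c + d - e) - (a + b' + c' + d' - e')) \<le> p1 + p2 + p3 + p4"
      if "norm (b - b') \<le> p1" "norm (c - c') \<le> p2" "norm (d - d') \<le> p3" "norm (e - e') \<le> p4"
      for a b c d e b' c' d' e' :: 'h and p1 p2 p3 p4
    proof -
      have "(a + b + c + d - e) - (a + b' + c' + d' - e') = (b - b') + (c - c') + (d - d') - (e - e')"
        by simp
      also have "norm \<dots> \<le> p1 + p2 + p3 + p4"
        using that norm_triangle_ineq[of "b - b'" "c - c'"]
          norm_triangle_ineq[of "(b - b') + (c - c')" "d - d'"]
          norm_triangle_ineq4[of "(b - b') + (c - c') + (d - d')" "e - e'"] by linarith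
      finally show ?thesis .
    qed
    have "norm (variation_of_constants u t - variation_of_constants v t) \<le> q \<rho> * m * exp (\<rho> * t)"
      using tri[OF 1 2 3 4, of "S t (\<xi> 0)"] \<rho> unfolding variation_of_constants_def q_def
      by (simp add: algebra_simps)
    then show ?thesis
      using t mu_pos variation_of_constants_0[of u] variation_of_constants_0[of v]
      by (cases "t = 0") (auto simp: solution_map_def)
  qed
  moreover have "0 \<le> damped_mass a \<rho> T" for a
    unfolding damped_mass_def by (intro integral_nonneg_AE AE_I2) auto
  then have "0 \<le> q \<rho>"
    using LF(1) LK(1) W(1) AG_const_nonneg \<rho>(2) by (simp add: q_def)
  ultimately show ?thesis
    using \<rho> by (intro exI[of _ \<rho>]) (auto intro!: bexI[of _ "q \<rho>"])
qed

theorem unique_global_mild_solution: "\<exists>!u. global_mild_solution \<mu> A S F G K \<xi> \<omega> u"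
proof -
  have "(\<lambda>t\<in>{-\<mu>..}. if t \<le> 0 then \<xi> t else \<xi> 0) \<in> admissible"
    by (rule glue_admissible) (rule continuous_on_const, rule refl)
  then show ?thesis
    unfolding global_mild_solution_iff
    using mu_pos solution_map_admissible solution_map_contraction
    by (intro Bielecki_contraction_unique_fixed_point[OF admissible_def]) simp_all
qed

end

section \<open>The existence and uniqueness theorem\<close>

theorem theorem2p4:
  fixes D :: "'h::{real_inner, banach, second_countable_topology} set"
    and A :: "'h \<Rightarrow> 'h"
    and S :: "real \<Rightarrow> 'h \<Rightarrow>\<^sub>L 'h"
    and F :: "(real \<Rightarrow> 'h) \<Rightarrow> 'h"
    and G K :: "(real \<Rightarrow> 'h) \<Rightarrow> ('u::{real_inner, banach, second_countable_topology} \<Rightarrow>\<^sub>L 'h)"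
    and \<mu> lam \<beta> \<nu> L\<^sub>G :: real
    and \<xi> :: "real \<Rightarrow> 'h"
    and \<omega> :: "real \<Rightarrow> 'u"
  assumes "0 < \<mu>"
    and "self_adjoint D (\<lambda>x. - A x)"
    and "strictly_positive D (\<lambda>x. - A x)"
    and "compact_inverse D (\<lambda>x. - A x)"
    and "analytic_semigroup S"
    and "generates D A S"
    and "0 < lam"
    and "semigroup_estimates S lam"
    and "0 < \<beta>" and "\<beta> < 1 / 2"
    and "lipschitz_seg \<mu> F"
    and "0 < \<nu>" and "\<nu> < 1"
    and "\<And>x. x \<in> C_seg \<mu> \<Longrightarrow> G x \<in> L_frac S \<nu>"
    and "\<And>x y. x \<in> C_seg \<mu> \<Longrightarrow> y \<in> C_seg \<mu> \<Longrightarrow>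
           norm_L_frac S \<nu> (G x - G y) \<le> L\<^sub>G * norm_seg \<mu> (\<lambda>s. x s - y s)"
    and "lipschitz_seg \<mu> K"
    and "\<And>T u. 0 < T \<Longrightarrow> continuous_on {-\<mu>..T} u \<Longrightarrow>
           (\<forall>t\<in>{0..T}. ((\<lambda>t. G (seg \<mu> u t)) has_vector_derivative K (seg \<mu> u t)) (at t within {0..T}))
           \<and> continuous_on {0..T} (\<lambda>t. K (seg \<mu> u t))"
    and "\<xi> \<in> C_seg \<mu>"
    and "\<omega> \<in> noise_paths \<beta>"
  shows "\<exists>!u. global_mild_solution \<mu> A S F G K \<xi> \<omega> u"
proof -
  have "continuous_on UNIV \<omega>" "\<omega> 0 = 0"
    using \<open>\<omega> \<in> noise_paths \<beta>\<close> by (simp_all add: noise_paths_def)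
  with assms interpret delay_equation D A S lam F G K \<mu> \<nu> L\<^sub>G \<xi> \<omega>
    by (intro delay_equation.intro parabolic_semigroup.intro delay_equation_axioms.intro)
  show ?thesis by (rule unique_global_mild_solution)
qed

end
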